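(* Let $r>0$, $\ell>0$, $\mu_0>0$. For $n>0$ let $\Gamma_{r,\ell,n}$ be the solenoid (helix) winding the cylinder of radius $r$ and length $\ell$ with $n$ turns per unit length, $\Gamma_{r,\ell,n}=\{(r\cos(2\pi nu),r\sin(2\pi nu),u):0\le u\le\ell\}$, of length $\mathcal{L}=\ell\sqrt{(2\pi nr)^2+1}$, parametrized by arc length by $\gamma:[0,\mathcal{L}]\to\mathbb{R}^3$. Define $$H_N(\Gamma_{r,\ell,n})=\lim_{\varepsilon\to0^+}\Big(\frac{\mu_0}{4\pi}\iint_{D_\varepsilon}\frac{\gamma'(s_1)\cdot\gamma'(s_2)}{|\gamma(s_1)-\gamma(s_2)|}\,ds_1ds_2+\frac{\mu_0\mathcal{L}}{2\pi}\log\varepsilon\Big),$$ $$H_W(\Gamma_{r,\ell,n})=\lim_{\varepsilon\to0^+}\Big(\frac{\mu_0}{4\pi}\iint_{D_\varepsilon}\frac{(\hat r_{12}\cdot\gamma'(s_1))(\hat r_{12}\cdot\gamma'(s_2))}{|\gamma(s_1)-\gamma(s_2)|}\,ds_1ds_2+\frac{\mu_0\mathcal{L}}{2\pi}\log\varepsilon\Big),$$ where $D_\varepsilon=\{(s_1,s_2)\in[0,\mathcal{L}]^2:|\gamma(s_1)-\gamma(s_2)|>\varepsilon\}$ and $\hat r_{12}=(\gamma(s_2)-\gamma(s_1))/|\gamma(s_2)-\gamma(s_1)|$. Then $$\lim_{n\to\infty}\frac{H_N(\Gamma_{r,\ell,n})}{n^2}=\lim_{n\to\infty}\frac{H_W(\Gamma_{r,\ell,n})}{n^2}=L_{r,\ell},$$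 where $$L_{r,\ell}=\frac{8\mu_0}{3}\Big[-r^3+\frac18\Big(-\ell(\ell^2-4r^2)E\Big(-\frac{4r^2}{\ell^2}\Big)+\ell(\ell^2+4r^2)K\Big(-\frac{4r^2}{\ell^2}\Big)\Big)\Big],$$ with $E(k)=\int_0^{\pi/2}\sqrt{1-k\sin^2t}\,dt$ and $K(k)=\int_0^{\pi/2}\frac{dt}{\sqrt{1-k\sin^2t}}$. Moreover, $$\lim_{\ell\to\infty}\Big(L_{r,\ell}-\mu_0\Big(\pi r^2\ell-\frac83r^3\Big)\Big)=0.$$
   Context: $H_N$ and $H_W$ are the regularized self-inductances in the sense of Neumann and Weber, defined by the same Hadamard-type regularization as for closed loops (removing pairs of points at Euclidean distance at most $\varepsilon$ and adding the counter term $\frac{\mu_0\mathcal{L}}{2\pi}\log\varepsilon$). $E$ and $K$ are the complete elliptic integrals of the second and first kind in the parameter convention above. *)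

theory Defs
  imports "HOL-Analysis.Analysis"
begin

text \<open>Speed of the helix u \<mapsto> (r cos(2 pi n u), r sin(2 pi n u), u).\<close>
definition helix_speed :: "real \<Rightarrow> real \<Rightarrow> real" where
  "helix_speed r n = sqrt ((2 * pi * n * r)^2 + 1)"

definition helix_len :: "real \<Rightarrow> real \<Rightarrow> real \<Rightarrow> real" where
  "helix_len r l n = l * sqrt ((2 * pi * n * r)^2 + 1)"

text \<open>Arc-length parametrization gamma of the solenoid (on [0, helix_len r l n]).\<close>
definition helix_gamma :: "real \<Rightarrow> real \<Rightarrow> real \<Rightarrow> real^3" where
  "helix_gamma r n s =
     vector [r * cos (2 * pi * n * (s / helix_speed r n)),
             r * sin (2 * pi * n * (s / helix_speed r n)),
             s / helix_speed r n]"

definition D_eps :: "(real \<Rightarrow> real^3) \<Rightarrow> real \<Rightarrow> real \<Rightarrow> (real \<times> real) set" where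
  "D_eps \<gamma> L \<epsilon> = {(s1, s2). s1 \<in> {0..L} \<and> s2 \<in> {0..L} \<and> dist (\<gamma> s1) (\<gamma> s2) > \<epsilon>}"

definition neumann_reg :: "real \<Rightarrow> (real \<Rightarrow> real^3) \<Rightarrow> real \<Rightarrow> real \<Rightarrow> real" where
  "neumann_reg \<mu>0 \<gamma> L \<epsilon> =
     \<mu>0 / (4 * pi) * integral (D_eps \<gamma> L \<epsilon>)
        (\<lambda>(s1, s2). (vector_derivative \<gamma> (at s1) \<bullet> vector_derivative \<gamma> (at s2))
                       / norm (\<gamma> s1 - \<gamma> s2))
     + \<mu>0 * L / (2 * pi) * ln \<epsilon>"

definition weber_reg :: "real \<Rightarrow> (real \<Rightarrow> real^3) \<Rightarrow> real \<Rightarrow> real \<Rightarrow> real" where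
  "weber_reg \<mu>0 \<gamma> L \<epsilon> =
     \<mu>0 / (4 * pi) * integral (D_eps \<gamma> L \<epsilon>)
        (\<lambda>(s1, s2). let rhat = (\<gamma> s2 - \<gamma> s1) /\<^sub>R norm (\<gamma> s2 - \<gamma> s1) in
           ((rhat \<bullet> vector_derivative \<gamma> (at s1)) * (rhat \<bullet> vector_derivative \<gamma> (at s2)))
             / norm (\<gamma> s1 - \<gamma> s2))
     + \<mu>0 * L / (2 * pi) * ln \<epsilon>"

definition H_N :: "real \<Rightarrow> real \<Rightarrow> real \<Rightarrow> real \<Rightarrow> real" where
  "H_N \<mu>0 r l n = Lim (at_right 0) (neumann_reg \<mu>0 (helix_gamma r n) (helix_len r l n))"

definition H_W :: "real \<Rightarrow> real \<Rightarrow> real \<Rightarrow> real \<Rightarrow> real" where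
  "H_W \<mu>0 r l n = Lim (at_right 0) (weber_reg \<mu>0 (helix_gamma r n) (helix_len r l n))"

text \<open>Complete elliptic integrals in the parameter convention.\<close>
definition ellipE :: "real \<Rightarrow> real" where
  "ellipE k = integral {0..pi/2} (\<lambda>t. sqrt (1 - k * (sin t)^2))"

definition ellipK :: "real \<Rightarrow> real" where
  "ellipK k = integral {0..pi/2} (\<lambda>t. 1 / sqrt (1 - k * (sin t)^2))"

definition L_rl :: "real \<Rightarrow> real \<Rightarrow> real \<Rightarrow> real" where
  "L_rl \<mu>0 r l = 8 * \<mu>0 / 3 *
     (- (r^3) + 1/8 * (- l * (l^2 - 4 * r^2) * ellipE (- 4 * r^2 / l^2)
                       + l * (l^2 + 4 * r^2) * ellipK (- 4 * r^2 / l^2)))"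

end

theory Submission
  imports Defs "HOL-Real_Asymp.Real_Asymp"
begin

text \<open>
  In the height coordinate both double integrals depend only on the difference \<open>t\<close> of the
  two heights, so they collapse to \<open>2 \<integral> (l - t) k(t) dt\<close>. Let \<open>D\<close> be the chord length as a
  function of \<open>t\<close> and \<open>c = D'(0)\<close> the speed of the helix. The Neumann kernel is \<open>D'' + D'^2 / D\<close>
  and the Weber kernel is \<open>D'^2 / D\<close>: their difference is the exact derivative \<open>D''\<close>, hence
  \<open>H_W\<close> and \<open>H_N\<close> differ only by \<open>O(n)\<close>. Near \<open>t = 0\<close> both kernels are \<open>c / t\<close> up to a bounded
  error, and the counter term cancels the resulting logarithm.

  After division by \<open>n^2\<close> only the oscillating integral of \<open>(l - t) cos(2 pi n t) / D\<close> over
  \<open>t \<ge> 1 / (2n)\<close> survives. Cutting it into periods \<open>t = (k + y / pi) / n\<close> makes the sum over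
  \<open>k\<close>, for fixed phase \<open>y\<close>, a Riemann sum of the decreasing function
  \<open>(l - t) / sqrt(b^2 + t^2)\<close> with \<open>b = 2 r |sin y|\<close>, whose error \<open>O((b n)^(-1/2))\<close> is
  integrable in \<open>y\<close>. The limit is \<open>\<integral> cos(2y) P(b) dy\<close> for an elementary \<open>P\<close> with
  \<open>P'(b) = 1 - sqrt(l^2 + b^2) / b\<close>, and integration by parts turns it into complete
  elliptic integrals.
\<close>

subsection \<open>Elliptic integrals\<close>

text \<open>The function \<open>m * sin y * cos y * ?D y\<close> vanishes at both ends of the
  interval, and its derivative is the combination of the three integrands; hence that combination
  integrates to zero.\<close>

lemma elliptic_cos2:
  fixes m :: real assumes "m \<ge> 0"
  shows "3 * m * integral {0..pi/2} (\<lambda>y. (cos y)^2 * sqrt (1 + m * (sin y)^2))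
    = (1 + m) * ellipK (-m) - (1 - m) * ellipE (-m)"
proof -
  let ?D = "\<lambda>y. sqrt (1 + m * (sin y)^2)"
  have pos: "1 + m * (sin y)^2 > 0" for y using assms by (simp add: add_pos_nonneg)
  have pos': "?D y > 0" for y using pos by simp
  have sq: "?D y * ?D y = 1 + m * (sin y)^2" for y using pos[of y] by simp
  have ne: "1 + m * (sin y)^2 \<noteq> 0" for y using pos[of y] by simp
  have I1: "(\<lambda>y. (cos y)^2 * ?D y) integrable_on {0..pi/2}"
    by (intro integrable_continuous_real continuous_intros)
  have I2: "?D integrable_on {0..pi/2}"
    by (intro integrable_continuous_real continuous_intros)
  have I3: "(\<lambda>y. 1 / ?D y) integrable_on {0..pi/2}"
    by (intro integrable_continuous_real continuous_intros) (use ne in auto)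
  have "((\<lambda>y. 3 * m * ((cos y)^2 * ?D y) + (1 - m) * ?D y - (1 + m) * (1 / ?D y)) has_integral
     (m * sin (pi/2) * cos (pi/2) * ?D (pi/2) - m * sin 0 * cos 0 * ?D 0)) {0..pi/2}"
  proof (rule fundamental_theorem_of_calculus)
    fix y :: real
    let ?e = "3 * m * ((cos y)^2 * ?D y) + (1 - m) * ?D y - (1 + m) * (1 / ?D y)"
    have c2: "(cos y)^2 = 1 - (sin y)^2" by (simp add: cos_squared_eq)
    have D: "((\<lambda>y. m * sin y * cos y * ?D y) has_real_derivative
       (m * ((cos y)^2 - (sin y)^2) * ?D y + m * sin y * cos y * (m * sin y * cos y / ?D y))) (at y)"
      using pos[of y] by (auto intro!: derivative_eq_intros simp: field_simps power2_eq_square)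
    \<comment> \<open>Multiplying by \<open>?D y\<close> removes the roots, so that both sides
      become polynomials in \<open>(sin y)^2\<close> and can be compared.\<close>
    have "(m * ((cos y)^2 - (sin y)^2) * ?D y + m * sin y * cos y * (m * sin y * cos y / ?D y)) * ?D y
        = m * ((cos y)^2 - (sin y)^2) * (?D y * ?D y) + m^2 * (sin y)^2 * (cos y)^2"
      using pos'[of y] by (simp add: field_simps power2_eq_square)
    also have "\<dots> = 3 * m * (cos y)^2 * (?D y * ?D y) + (1 - m) * (?D y * ?D y) - (1 + m)"
      unfolding sq c2 by algebra
    also have "\<dots> = ?e * ?D y"
      using pos'[of y] by (simp add: field_simps)
    finally have "m * ((cos y)^2 - (sin y)^2) * ?D y + m * sin y * cos y * (m * sin y * cos y / ?D y) = ?e"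
      using pos'[of y] by (metis mult_right_cancel less_irrefl)
    with D show "((\<lambda>y. m * sin y * cos y * ?D y) has_vector_derivative ?e) (at y within {0..pi/2})"
      by (simp add: has_real_derivative_iff_has_vector_derivative has_vector_derivative_at_within)
  qed simp
  then have "((\<lambda>y. 3 * m * ((cos y)^2 * ?D y) + (1 - m) * ?D y - (1 + m) * (1 / ?D y)) has_integral 0) {0..pi/2}"
    by simp
  moreover have "((\<lambda>y. 3 * m * ((cos y)^2 * ?D y) + (1 - m) * ?D y - (1 + m) * (1 / ?D y)) has_integral
    (3 * m * integral {0..pi/2} (\<lambda>y. (cos y)^2 * ?D y) + (1 - m) * integral {0..pi/2} ?D
      - (1 + m) * integral {0..pi/2} (\<lambda>y. 1 / ?D y))) {0..pi/2}"
    using I1 I2 I3 by (intro has_integral_diff has_integral_add has_integral_mult_right) auto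
  ultimately have "3 * m * integral {0..pi/2} (\<lambda>y. (cos y)^2 * ?D y) + (1 - m) * integral {0..pi/2} ?D
      - (1 + m) * integral {0..pi/2} (\<lambda>y. 1 / ?D y) = 0"
    by (rule has_integral_unique[symmetric])
  then show ?thesis unfolding ellipE_def ellipK_def by simp
qed

text \<open>Pulling \<open>l\<close> out of the root gives the parameter
  \<open>4 * r^2 / l^2\<close>, and the factor \<open>l^3\<close> clears the denominators. The limit
  in \<open>n\<close> and the expansion in \<open>l\<close> are both computed from this
  form.\<close>

lemma L_rl_eq:
  assumes "l > 0"
  shows "L_rl \<mu>0 r l = 4 * \<mu>0 * r^2 *
    (- 2 * r / 3 + integral {0..pi/2} (\<lambda>y. (cos y)^2 * sqrt (l^2 + (2 * r * sin y)^2)))"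
proof -
  let ?m = "4 * r^2 / l^2"
  have "sqrt (l^2 + (2 * r * sin y)^2) = l * sqrt (1 + ?m * (sin y)^2)" for y
  proof -
    have "l^2 + (2 * r * sin y)^2 = l^2 * (1 + ?m * (sin y)^2)"
      using assms by (simp add: field_simps)
    then show ?thesis using assms by (simp add: real_sqrt_mult)
  qed
  then have "integral {0..pi/2} (\<lambda>y. (cos y)^2 * sqrt (l^2 + (2 * r * sin y)^2))
     = integral {0..pi/2} (\<lambda>y. l * ((cos y)^2 * sqrt (1 + ?m * (sin y)^2)))"
    by (simp add: mult_ac)
  also have "\<dots> = l * integral {0..pi/2} (\<lambda>y. (cos y)^2 * sqrt (1 + ?m * (sin y)^2))"
    by simp
  finally have *: "integral {0..pi/2} (\<lambda>y. (cos y)^2 * sqrt (l^2 + (2 * r * sin y)^2)) = \<dots>" .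
  have E: "3 * ?m * integral {0..pi/2} (\<lambda>y. (cos y)^2 * sqrt (1 + ?m * (sin y)^2))
    = (1 + ?m) * ellipK (-?m) - (1 - ?m) * ellipE (-?m)"
    by (rule elliptic_cos2) simp
  have "l^3 * (3 * ?m * integral {0..pi/2} (\<lambda>y. (cos y)^2 * sqrt (1 + ?m * (sin y)^2)))
    = l * (l^2 + 4 * r^2) * ellipK (-?m) - l * (l^2 - 4 * r^2) * ellipE (-?m)"
    unfolding E using assms by (simp add: field_simps power3_eq_cube power2_eq_square)
  moreover have "l^3 * (3 * ?m * X) = 12 * r^2 * l * X" for X
    using assms by (simp add: field_simps power3_eq_cube power2_eq_square)
  ultimately have "12 * r^2 * l * integral {0..pi/2} (\<lambda>y. (cos y)^2 * sqrt (1 + ?m * (sin y)^2))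
    = l * (l^2 + 4 * r^2) * ellipK (-?m) - l * (l^2 - 4 * r^2) * ellipE (-?m)" by metis
  then have "l * (l^2 + 4 * r^2) * ellipK (-?m) = 12 * r^2 * l * integral {0..pi/2} (\<lambda>y. (cos y)^2 * sqrt (1 + ?m * (sin y)^2)) + l * (l^2 - 4 * r^2) * ellipE (-?m)" by simp
  then show ?thesis
    unfolding L_rl_def * by (simp add: algebra_simps power3_eq_cube power2_eq_square)
qed

lemma integral_cos_sq: "((\<lambda>y. (cos y)^2) has_integral pi/4) {0..pi/2}"
proof -
  have "((\<lambda>y. (cos y)^2) has_integral ((pi/2)/2 + sin (pi/2) * cos (pi/2) / 2 - (0/2 + sin 0 * cos 0 / 2))) {0..pi/2}"
  proof (rule fundamental_theorem_of_calculus)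
    fix y :: real
    have "((\<lambda>y. y / 2 + sin y * cos y / 2) has_real_derivative (cos y)^2) (at y)"
      by (auto intro!: derivative_eq_intros simp: cos_squared_eq power2_eq_square[symmetric] field_simps)
    then show "((\<lambda>y. y / 2 + sin y * cos y / 2) has_vector_derivative (cos y)^2) (at y within {0..pi/2})"
      by (simp add: has_real_derivative_iff_has_vector_derivative has_vector_derivative_at_within)
  qed simp
  then show ?thesis by simp
qed

text \<open>The root lies between \<open>l\<close> and \<open>l + 2 * r^2 / l\<close>, and the
  weight \<open>(cos y)^2\<close> has integral \<open>pi / 4\<close>; what remains is of order
  \<open>1 / l\<close>.\<close>

lemma L_rl_asymptotics:
  "((\<lambda>l. L_rl \<mu>0 r l - \<mu>0 * (pi * r^2 * l - 8/3 * r^3)) \<longlongrightarrow> 0) at_top"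
proof -
  let ?I = "\<lambda>l. integral {0..pi/2} (\<lambda>y. (cos y)^2 * sqrt (l^2 + (2 * r * sin y)^2))"
  have bounds: "0 \<le> ?I l - pi/4 * l \<and> ?I l - pi/4 * l \<le> pi / 4 * (2 * r^2 / l)" if "l > 0" for l
  proof -
    have i1: "((\<lambda>y. (cos y)^2 * sqrt (l^2 + (2 * r * sin y)^2) - (cos y)^2 * l) has_integral (?I l - pi/4 * l)) {0..pi/2}"
      by (intro has_integral_diff integrable_integral integrable_continuous_real continuous_intros
          has_integral_mult_left integral_cos_sq)
    have i2: "((\<lambda>y. (cos y)^2 * (2 * r^2 / l)) has_integral (pi/4 * (2 * r^2 / l))) {0..pi/2}"
      by (intro has_integral_mult_left integral_cos_sq)
    have lo: "l \<le> sqrt (l^2 + (2 * r * sin y)^2)" for y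
      using that by (intro real_le_rsqrt) simp
    have hi: "sqrt (l^2 + (2 * r * sin y)^2) \<le> l + 2 * r^2 / l" for y
    proof (rule real_le_lsqrt)
      have "(sin y)^2 \<le> 1" by (simp add: abs_square_le_1)
      then have "(2 * r * sin y)^2 \<le> 4 * r^2"
        by (simp add: power_mult_distrib mult_left_le)
      moreover have "(l + 2 * r^2 / l)^2 = l^2 + 4 * r^2 + (2 * r^2 / l)^2"
        using that by (simp add: power2_sum)
      ultimately show "l^2 + (2 * r * sin y)^2 \<le> (l + 2 * r^2 / l)^2"
        by (smt (verit) zero_le_power2)
    qed (use that in auto)
    have "0 \<le> ?I l - pi/4 * l"
      by (rule has_integral_nonneg[OF i1]) (use lo in \<open>auto intro!: mult_left_mono\<close>)
    moreover have "?I l - pi/4 * l \<le> pi/4 * (2 * r^2 / l)"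
    proof (rule has_integral_le[OF i1 i2])
      fix y show "(cos y)^2 * sqrt (l^2 + (2 * r * sin y)^2) - (cos y)^2 * l \<le> (cos y)^2 * (2 * r^2 / l)"
        using mult_left_mono[OF hi[of y], of "(cos y)^2"] by (simp add: algebra_simps)
    qed
    ultimately show ?thesis by blast
  qed
  have "((\<lambda>l. ?I l - pi/4 * l) \<longlongrightarrow> 0) at_top"
  proof (rule tendsto_sandwich)
    show "\<forall>\<^sub>F l in at_top. 0 \<le> ?I l - pi/4 * l"
      using eventually_gt_at_top[of 0] by eventually_elim (use bounds in blast)
    show "\<forall>\<^sub>F l in at_top. ?I l - pi/4 * l \<le> pi / 4 * (2 * r^2 / l)"
      using eventually_gt_at_top[of 0] by eventually_elim (use bounds in blast)
    show "((\<lambda>l. pi / 4 * (2 * r^2 / l)) \<longlongrightarrow> 0) at_top" by real_asymp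
  qed simp
  then have "((\<lambda>l. 4 * \<mu>0 * r^2 * (?I l - pi/4 * l)) \<longlongrightarrow> 0) at_top"
    by (rule tendsto_mult_right_zero)
  then show ?thesis
  proof (rule Lim_transform_eventually)
    show "\<forall>\<^sub>F l in at_top. 4 * \<mu>0 * r^2 * (?I l - pi/4 * l) = L_rl \<mu>0 r l - \<mu>0 * (pi * r^2 * l - 8/3 * r^3)"
      using eventually_gt_at_top[of 0]
      by eventually_elim (simp add: L_rl_eq algebra_simps power3_eq_cube power2_eq_square)
  qed
qed

subsection \<open>The helix kernels\<close>

text \<open>Distance of two points of the helix whose heights differ by \<open>t\<close>. The first
  summand is the squared chord of a circle of radius \<open>r\<close> over the angle
  \<open>2 * pi * n * t\<close>.\<close>

definition chord :: "real \<Rightarrow> real \<Rightarrow> real \<Rightarrow> real" where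
  "chord r n t = sqrt (4 * r^2 * (sin (pi * n * t))^2 + t^2)"

text \<open>Derivative of the chord length for \<open>t > 0\<close>. At \<open>t = 0\<close> the
  quotient is 0 by convention, which differs from its right limit
  \<open>helix_speed r n\<close>.\<close>

definition chord_slope :: "real \<Rightarrow> real \<Rightarrow> real \<Rightarrow> real" where
  "chord_slope r n t = (2 * pi * n * r^2 * sin (2 * pi * n * t) + t) / chord r n t"

text \<open>The kernels are integrands with respect to height: the factor
  \<open>(helix_speed r n)^2\<close> from the two arc-length elements is absorbed into them.\<close>

definition neumann_kernel :: "real \<Rightarrow> real \<Rightarrow> real \<Rightarrow> real" where
  "neumann_kernel r n t = ((2 * pi * n * r)^2 * cos (2 * pi * n * t) + 1) / chord r n t"

definition weber_kernel :: "real \<Rightarrow> real \<Rightarrow> real \<Rightarrow> real" where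
  "weber_kernel r n t = (chord_slope r n t)^2 / chord r n t"

lemma helix_speed_pos: "helix_speed r n > 0"
  unfolding helix_speed_def by (simp add: add_nonneg_pos)

lemma helix_speed_sq: "(helix_speed r n)^2 = (2 * pi * n * r)^2 + 1"
  unfolding helix_speed_def by (simp add: add_nonneg_nonneg)

lemma helix_len_eq: "helix_len r l n = l * helix_speed r n"
  unfolding helix_len_def helix_speed_def ..

lemma chord_minus [simp]: "chord r n (- t) = chord r n t"
  unfolding chord_def by simp

lemma neumann_kernel_minus [simp]: "neumann_kernel r n (- t) = neumann_kernel r n t"
  unfolding neumann_kernel_def by simp

lemma chord_slope_minus [simp]: "chord_slope r n (- t) = - chord_slope r n t"
  unfolding chord_slope_def by (simp add: divide_simps)

lemma weber_kernel_minus [simp]: "weber_kernel r n (- t) = weber_kernel r n t"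
  unfolding weber_kernel_def by simp

lemma has_vector_derivative_helix_gamma:
  defines "c \<equiv> \<lambda>r n. helix_speed r n"
  shows "(helix_gamma r n has_vector_derivative
     vector [- (2 * pi * n * r / c r n) * sin (2 * pi * n * (s / c r n)),
             (2 * pi * n * r / c r n) * cos (2 * pi * n * (s / c r n)),
             1 / c r n]) (at s)"
proof -
  have c: "c r n \<noteq> 0" using helix_speed_pos[of r n] unfolding c_def by simp
  \<comment> \<open>As a sum of scaled axis vectors the curve can be differentiated coordinate by
    coordinate.\<close>
  have split: "vector [x, y, z] = x *\<^sub>R axis 1 1 + y *\<^sub>R axis 2 1 + z *\<^sub>R (axis 3 1 :: real^3)" for x y z
    by (simp add: vec_eq_iff forall_3 vector_3 axis_def)
  have "((\<lambda>s. (r * cos (2 * pi * n * (s / c r n))) *\<^sub>R axis 1 1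
           + (r * sin (2 * pi * n * (s / c r n))) *\<^sub>R axis 2 1
           + (s / c r n) *\<^sub>R (axis 3 1 :: real^3)) has_vector_derivative
     (- (2 * pi * n * r / c r n) * sin (2 * pi * n * (s / c r n))) *\<^sub>R axis 1 1
       + ((2 * pi * n * r / c r n) * cos (2 * pi * n * (s / c r n))) *\<^sub>R axis 2 1
       + (1 / c r n) *\<^sub>R axis 3 1) (at s)"
    using c by (auto intro!: derivative_eq_intros simp: field_simps)
  then show ?thesis
    unfolding helix_gamma_def split c_def by (simp add: fun_eq_iff)
qed

lemmas vector_derivative_helix_gamma =
  vector_derivative_at[OF has_vector_derivative_helix_gamma]

lemma inner_vector_3:
  "(vector [a, b, c] :: real^3) \<bullet> vector [a', b', c'] = a * a' + b * b' + c * c'"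
  by (simp add: inner_vec_def sum_3 vector_3)

lemma diff_vector_3:
  "(vector [a, b, c] :: real^3) - vector [a', b', c'] = vector [a - a', b - b', c - c']"
  by (simp add: vec_eq_iff forall_3 vector_3)

text \<open>The horizontal displacement contributes \<open>r^2 * (2 - 2 * cos (x - y))\<close>,
  where \<open>x\<close> and \<open>y\<close> are the two angles; the half-angle formula turns this
  into the sine term of \<open>chord\<close>.\<close>

lemma norm_helix_gamma_diff:
  "norm (helix_gamma r n s1 - helix_gamma r n s2) = chord r n ((s1 - s2) / helix_speed r n)"
proof -
  define c where "c = helix_speed r n"
  define x where "x = 2 * pi * n * (s1 / c)"
  define y where "y = 2 * pi * n * (s2 / c)"
  have xy: "pi * n * ((s1 - s2) / c) = (x - y) / 2"
    unfolding x_def y_def by (simp add: field_simps diff_divide_distrib)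
  have "cos (x - y) = 1 - 2 * (sin ((x - y) / 2))^2"
    using cos_double_sin[of "(x - y) / 2"] by (simp only: times_divide_eq_right nonzero_mult_div_cancel_left)
  then have h: "4 * (sin ((x - y) / 2))^2 = 2 - 2 * (cos x * cos y + sin x * sin y)"
    by (simp add: cos_diff)
  have "(r * cos x - r * cos y)^2 + (r * sin x - r * sin y)^2
     = r^2 * (((sin x)^2 + (cos x)^2) + ((sin y)^2 + (cos y)^2) - 2 * (cos x * cos y + sin x * sin y))"
    by algebra
  also have "\<dots> = r^2 * (4 * (sin ((x - y) / 2))^2)"
    unfolding h by simp
  finally have e: "(r * cos x - r * cos y)^2 + (r * sin x - r * sin y)^2 = r^2 * (4 * (sin ((x - y) / 2))^2)" .
  have "(norm (helix_gamma r n s1 - helix_gamma r n s2))^2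
    = (r * cos x - r * cos y)^2 + (r * sin x - r * sin y)^2 + ((s1 - s2) / c)^2"
    unfolding power2_norm_eq_inner helix_gamma_def diff_vector_3 inner_vector_3
      c_def[symmetric] x_def[symmetric] y_def[symmetric]
    by (simp add: power2_eq_square diff_divide_distrib)
  also have "\<dots> = 4 * r^2 * (sin (pi * n * ((s1 - s2) / c)))^2 + ((s1 - s2) / c)^2"
    unfolding e xy by simp
  finally show ?thesis
    unfolding chord_def c_def[symmetric] by (metis norm_ge_zero real_sqrt_unique)
qed

lemma helix_tangent_inner:
  "vector_derivative (helix_gamma r n) (at s1) \<bullet> vector_derivative (helix_gamma r n) (at s2)
   = ((2 * pi * n * r)^2 * cos (2 * pi * n * ((s1 - s2) / helix_speed r n)) + 1) / (helix_speed r n)^2"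
proof -
  have xy: "2 * pi * n * ((s1 - s2) / c) = 2 * pi * n * (s1 / c) - 2 * pi * n * (s2 / c)" for c
    by (simp add: field_simps diff_divide_distrib)
  show ?thesis
    unfolding vector_derivative_helix_gamma inner_vector_3 xy cos_diff
    using helix_speed_pos[of r n] by (simp add: field_simps power2_eq_square)
qed

text \<open>Some half-turn of space maps the infinite helix to itself and exchanges the two points,
  so the chord makes the same angle with both tangents. Therefore the Weber product is a perfect
  square.\<close>

lemma helix_chord_inner_tangent:
  defines "q \<equiv> \<lambda>r n t. 2 * pi * n * r^2 * sin (2 * pi * n * t) + t"
  shows "(helix_gamma r n s2 - helix_gamma r n s1) \<bullet> vector_derivative (helix_gamma r n) (at s1)
     = q r n ((s2 - s1) / helix_speed r n) / helix_speed r n"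
   and "(helix_gamma r n s2 - helix_gamma r n s1) \<bullet> vector_derivative (helix_gamma r n) (at s2)
     = q r n ((s2 - s1) / helix_speed r n) / helix_speed r n"
proof -
  define c where "c = helix_speed r n"
  have c: "c \<noteq> 0" using helix_speed_pos[of r n] unfolding c_def by simp
  define x where "x = 2 * pi * n * (s1 / c)"
  define y where "y = 2 * pi * n * (s2 / c)"
  have xy: "2 * pi * n * ((s2 - s1) / c) = y - x"
    unfolding x_def y_def by (simp add: field_simps diff_divide_distrib)
  show "(helix_gamma r n s2 - helix_gamma r n s1) \<bullet> vector_derivative (helix_gamma r n) (at s1)
     = q r n ((s2 - s1) / helix_speed r n) / helix_speed r n"
    unfolding vector_derivative_helix_gamma helix_gamma_def diff_vector_3 inner_vector_3 q_def
      c_def[symmetric] xy unfolding x_def[symmetric] y_def[symmetric] sin_diff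
    using c by (simp add: field_simps power2_eq_square)
  show "(helix_gamma r n s2 - helix_gamma r n s1) \<bullet> vector_derivative (helix_gamma r n) (at s2)
     = q r n ((s2 - s1) / helix_speed r n) / helix_speed r n"
    unfolding vector_derivative_helix_gamma helix_gamma_def diff_vector_3 inner_vector_3 q_def
      c_def[symmetric] xy unfolding x_def[symmetric] y_def[symmetric] sin_diff
    using c by (simp add: field_simps power2_eq_square)
qed

lemma neumann_integrand_helix:
  "vector_derivative (helix_gamma r n) (at s1) \<bullet> vector_derivative (helix_gamma r n) (at s2)
      / norm (helix_gamma r n s1 - helix_gamma r n s2)
   = neumann_kernel r n ((s1 - s2) / helix_speed r n) / (helix_speed r n)^2"
  unfolding helix_tangent_inner norm_helix_gamma_diff neumann_kernel_def by (simp add: mult.commute)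

lemma weber_integrand_helix:
  defines "rhat \<equiv> \<lambda>r n s1 s2. (helix_gamma r n s2 - helix_gamma r n s1) /\<^sub>R norm (helix_gamma r n s2 - helix_gamma r n s1)"
  shows "(rhat r n s1 s2 \<bullet> vector_derivative (helix_gamma r n) (at s1))
      * (rhat r n s1 s2 \<bullet> vector_derivative (helix_gamma r n) (at s2))
      / norm (helix_gamma r n s1 - helix_gamma r n s2)
   = weber_kernel r n ((s1 - s2) / helix_speed r n) / (helix_speed r n)^2"
proof -
  \<comment> \<open>Weber's unit vector points from \<open>s1\<close> to \<open>s2\<close>, whereas
    the kernel is taken at \<open>s1 - s2\<close>; evenness absorbs the sign.\<close>
  have e: "(s1 - s2) / helix_speed r n = - ((s2 - s1) / helix_speed r n)" by (simp add: minus_divide_left)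
  show ?thesis
    unfolding rhat_def inner_scaleR_left helix_chord_inner_tangent norm_helix_gamma_diff
      e chord_minus weber_kernel_minus
    unfolding weber_kernel_def chord_slope_def
    by (simp add: divide_simps power2_eq_square)
qed

subsection \<open>Reduction to one variable\<close>

lemma integrable_bounded_support:
  fixes f :: "'a::euclidean_space \<Rightarrow> real"
  assumes [measurable]: "f \<in> borel_measurable borel" and "\<And>z. \<bar>f z\<bar> \<le> B"
    and "\<And>z. z \<notin> cbox a b \<Longrightarrow> f z = 0"
  shows "integrable lborel f"
proof (rule Bochner_Integration.integrable_bound)
  show "integrable lborel (\<lambda>z. indicator (cbox a b) z * B)"
    by (intro integrable_mult_left integrable_real_indicator) (simp_all add: emeasure_lborel_cbox_eq)
  show "AE z in lborel. norm (f z) \<le> norm (indicator (cbox a b) z * B)"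
  proof (rule AE_I2)
    fix z
    show "norm (f z) \<le> norm (indicator (cbox a b) z * B)"
      using assms(2)[of z] assms(3)[of z] by (cases "z \<in> cbox a b") auto
  qed
qed simp

text \<open>The points of the square with difference \<open>t\<close> form a diagonal segment whose
  projection has length \<open>L - \<bar>t\<bar>\<close>, and evenness folds the negative
  differences onto the positive ones. Boundedness makes all integrals absolutely convergent, so
  Fubini applies.\<close>

lemma integral_square_difference:
  fixes F :: "real \<Rightarrow> real"
  assumes F [measurable]: "F \<in> borel_measurable borel" and bound: "\<And>x. \<bar>F x\<bar> \<le> B"
    and even: "\<And>x. F (- x) = F x" and L: "L \<ge> 0"
  shows "integral ({0..L} \<times> {0..L}) (\<lambda>(x, y). F (x - y)) = 2 * integral {0..L} (\<lambda>s. (L - s) * F s)"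
proof -
  define I where "I = (indicator {0..L} :: real \<Rightarrow> real)"
  have [measurable]: "I \<in> borel_measurable borel" unfolding I_def by simp
  have I01: "0 \<le> I x" "I x \<le> 1" for x unfolding I_def by (auto simp: indicator_def)
  have IB: "\<bar>I x * I y * F z\<bar> \<le> B" for x y z
  proof -
    have "\<bar>I x * I y * F z\<bar> = (I x * I y) * \<bar>F z\<bar>" using I01 by (simp add: abs_mult)
    also have "\<dots> \<le> 1 * \<bar>F z\<bar>" using I01 by (intro mult_right_mono mult_le_one) auto
    finally show ?thesis using bound[of z] by simp
  qed
  have Inz: "0 \<le> x \<and> x \<le> L" if "I x \<noteq> 0" for x
    using that unfolding I_def by (auto simp: indicator_def split: if_splits)
  have int1: "integrable lborel (\<lambda>(x, y). I x * I y * F (x - y))"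
  proof (rule integrable_bounded_support[where B = B and a = "(0, 0)" and b = "(L, L)"])
    show "(\<lambda>(x, y). I x * I y * F (x - y)) \<in> borel_measurable borel"
      unfolding borel_prod[symmetric] by measurable
  qed (auto simp: cbox_Pair_eq IB dest!: Inz)
  have int2: "integrable lborel (\<lambda>(x, t). I x * I (x - t) * F t)"
  proof (rule integrable_bounded_support[where B = B and a = "(0, -L)" and b = "(L, L)"])
    show "(\<lambda>(x, t). I x * I (x - t) * F t) \<in> borel_measurable borel"
      unfolding borel_prod[symmetric] by measurable
  qed (auto simp: cbox_Pair_eq IB dest!: Inz)
  \<comment> \<open>For fixed \<open>t\<close> the admissible \<open>x\<close> fill the overlap of
    \<open>{0..L}\<close> with its translate by \<open>t\<close>.\<close>
  have inner: "(LBINT x. I x * I (x - t) * F t) = max 0 (L - \<bar>t\<bar>) * F t" for t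
  proof -
    have "I x * I (x - t) = indicator {max 0 t..min L (L + t)} x" for x
      unfolding I_def by (auto simp: indicator_def)
    then have "(LBINT x. I x * I (x - t) * F t) = (LBINT x. indicator {max 0 t..min L (L + t)} x) * F t"
      by simp
    also have "(LBINT x. indicator {max 0 t..min L (L + t)} x) = max 0 (L - \<bar>t\<bar>)"
      by (simp add: measure_def emeasure_lborel_Icc_eq max_def min_def)
    finally show ?thesis .
  qed
  have "integral ({0..L} \<times> {0..L}) (\<lambda>(x, y). F (x - y)) = integral UNIV (\<lambda>(x, y). I x * I y * F (x - y))"
    unfolding I_def by (subst integral_restrict_UNIV[symmetric]) (auto intro!: arg_cong[where f = "integral UNIV"] simp: indicator_def)
  \<comment> \<open>The gauge integral becomes a Lebesgue integral for the use of Fubini; the way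
    back follows once one variable is left.\<close>
  also have "\<dots> = (LBINT z. (case z of (x, y) \<Rightarrow> I x * I y * F (x - y)))"
    by (rule integral_lborel[OF int1])
  also have "\<dots> = (LBINT x. LBINT y. I x * I y * F (x - y))"
    using int1 by (subst lborel_prod[symmetric], subst lborel_pair.integral_fst'[symmetric]) (auto simp: lborel_prod)
  \<comment> \<open>shear the square along its diagonal, then exchange the order of integration\<close>
  also have "\<dots> = (LBINT x. LBINT t. I x * I (x - t) * F t)"
  proof (rule Bochner_Integration.integral_cong[OF refl])
    fix x
    show "(LBINT y. I x * I y * F (x - y)) = (LBINT t. I x * I (x - t) * F t)"
      using lborel_integral_real_affine[of "-1" "\<lambda>y. I x * I y * F (x - y)" x] by simp
  qed
  also have "\<dots> = (LBINT t. LBINT x. I x * I (x - t) * F t)"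
    by (rule lborel_pair.Fubini_integral[symmetric]) (use int2 in \<open>simp add: lborel_prod\<close>)
  also have "\<dots> = (LBINT t. max 0 (L - \<bar>t\<bar>) * F t)"
    unfolding inner ..
  also have "\<dots> = integral {-L..L} (\<lambda>t. (L - \<bar>t\<bar>) * F t)"
  proof -
    have "integrable lborel (\<lambda>t. max 0 (L - \<bar>t\<bar>) * F t)"
    proof (rule integrable_bounded_support[where B = "L * B" and a = "-L" and b = L])
      fix t show "\<bar>max 0 (L - \<bar>t\<bar>) * F t\<bar> \<le> L * B"
        unfolding abs_mult using L bound[of t] by (intro mult_mono) auto
    qed auto
    then have "(LBINT t. max 0 (L - \<bar>t\<bar>) * F t) = integral UNIV (\<lambda>t. max 0 (L - \<bar>t\<bar>) * F t)"
      by (rule integral_lborel[symmetric])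
    also have "\<dots> = integral UNIV (\<lambda>t. if t \<in> {-L..L} then (L - \<bar>t\<bar>) * F t else 0)"
      by (rule arg_cong[where f = "integral UNIV"]) (auto simp: fun_eq_iff)
    finally show ?thesis unfolding Henstock_Kurzweil_Integration.integral_restrict_UNIV .
  qed
  also have "\<dots> = integral {-L..0} (\<lambda>t. (L - \<bar>t\<bar>) * F t) + integral {0..L} (\<lambda>t. (L - \<bar>t\<bar>) * F t)"
  proof (rule Henstock_Kurzweil_Integration.integral_combine[symmetric])
    show "(\<lambda>t. (L - \<bar>t\<bar>) * F t) integrable_on {-L..L}"
    proof (rule measurable_bounded_by_integrable_imp_integrable[where g = "\<lambda>_. L * B"])
      show "norm ((L - \<bar>t\<bar>) * F t) \<le> L * B" if "t \<in> {-L..L}" for t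
        unfolding norm_mult using L bound[of t] that by (intro mult_mono) auto
      have "(\<lambda>t. (L - \<bar>t\<bar>) * F t) \<in> borel_measurable borel" by measurable
      then show "(\<lambda>t. (L - \<bar>t\<bar>) * F t) \<in> borel_measurable (lebesgue_on {-L..L})"
        by (intro measurable_restrict_space1 measurable_completion) simp
    qed auto
  qed (use L in auto)
  also have "integral {-L..0} (\<lambda>t. (L - \<bar>t\<bar>) * F t) = integral {0..L} (\<lambda>t. (L - \<bar>t\<bar>) * F t)"
    using Henstock_Kurzweil_Integration.integral_reflect_real[of L 0 "\<lambda>t. (L - \<bar>t\<bar>) * F t"] by (simp add: even)
  also have "integral {0..L} (\<lambda>t. (L - \<bar>t\<bar>) * F t) = integral {0..L} (\<lambda>t. (L - t) * F t)"
    by (rule Henstock_Kurzweil_Integration.integral_cong) simp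
  finally show ?thesis by simp
qed

section \<open>Geometry of the chord length: bounds, monotonicity, behaviour at zero and
  derivatives\<close>

lemma chord_sq: "(chord r n t)^2 = 4 * r^2 * (sin (pi * n * t))^2 + t^2"
  unfolding chord_def by simp

lemma chord_nonneg [simp]: "chord r n t \<ge> 0"
  unfolding chord_def by simp

lemma chord_zero [simp]: "chord r n 0 = 0"
  unfolding chord_def by simp

lemma abs_le_chord: "\<bar>t\<bar> \<le> chord r n t"
  unfolding chord_def by (intro real_le_rsqrt) simp

lemma chord_pos: "t \<noteq> 0 \<Longrightarrow> chord r n t > 0"
  using abs_le_chord[of t r n] by linarith

lemma chord_eq_0_iff [simp]: "chord r n t = 0 \<longleftrightarrow> t = 0"
  using chord_pos[of t r n] by force

lemma continuous_on_chord [continuous_intros]: "continuous_on S (chord r n)"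
  unfolding chord_def by (intro continuous_intros)

text \<open>A chord is no longer than its arc; analytically this is
  \<open>\<bar>sin x\<bar> \<le> \<bar>x\<bar>\<close>.\<close>

lemma chord_le_speed: "chord r n t \<le> helix_speed r n * \<bar>t\<bar>"
proof (rule power2_le_imp_le)
  have "(sin (pi * n * t))^2 \<le> (pi * n * t)^2"
    using abs_sin_x_le_abs_x[of "pi * n * t"] by (simp add: abs_le_square_iff)
  then have "4 * r^2 * (sin (pi * n * t))^2 \<le> 4 * r^2 * (pi * n * t)^2"
    by (intro mult_left_mono) auto
  then show "(chord r n t)^2 \<le> (helix_speed r n * \<bar>t\<bar>)^2"
    unfolding chord_sq power_mult_distrib helix_speed_sq by (simp add: algebra_simps)
qed (use helix_speed_pos[of r n] in simp)

text \<open>During the first half turn the sine does not decrease, and the summand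
  \<open>t^2\<close> makes the growth strict.\<close>

lemma chord_strict_mono:
  assumes "n > 0" "0 \<le> s" "s < t" "t \<le> 1 / (2 * n)"
  shows "chord r n s < chord r n t"
proof -
  have "pi * n * t \<le> pi / 2"
    using assms mult_left_mono[OF assms(4), of "pi * n"] by (simp add: field_simps)
  then have "sin (pi * n * s) \<le> sin (pi * n * t)"
    using assms by (intro sin_monotone_2pi_le mult_left_mono) (auto intro: order_trans[of _ 0])
  moreover have "0 \<le> sin (pi * n * s)"
  proof (rule sin_ge_zero)
    have "pi * n * s \<le> pi * n * t" using assms by (intro mult_left_mono) auto
    with \<open>pi * n * t \<le> pi / 2\<close> show "pi * n * s \<le> pi" using pi_ge_zero by linarith
  qed (use assms in simp)
  ultimately have "(sin (pi * n * s))^2 \<le> (sin (pi * n * t))^2" by (rule power_mono)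
  then have "4 * r^2 * (sin (pi * n * s))^2 \<le> 4 * r^2 * (sin (pi * n * t))^2"
    by (rule mult_left_mono) simp
  moreover have "s^2 < t^2" using assms by (intro power_strict_mono) auto
  ultimately show ?thesis unfolding chord_def by simp
qed

lemma chord_over_tendsto:
  "((\<lambda>t. chord r n t / t) \<longlongrightarrow> helix_speed r n) (at_right 0)"
proof -
  have "((\<lambda>t. sin (pi * n * t) / t) \<longlongrightarrow> pi * n) (at_right 0)"
    by (cases "n = 0"; real_asymp)
  then have "((\<lambda>t. sqrt (4 * r^2 * (sin (pi * n * t) / t)^2 + 1)) \<longlongrightarrow> sqrt (4 * r^2 * (pi * n)^2 + 1)) (at_right 0)"
    by (intro tendsto_intros)
  moreover have "sqrt (4 * r^2 * (pi * n)^2 + 1) = helix_speed r n"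
    unfolding helix_speed_def by (simp add: power_mult_distrib mult_ac)
  moreover have "\<forall>\<^sub>F t in at_right 0. sqrt (4 * r^2 * (sin (pi * n * t) / t)^2 + 1) = chord r n t / t"
    using eventually_at_right_less[of 0]
  proof eventually_elim
    case (elim t)
    have "4 * r^2 * (sin (pi * n * t) / t)^2 + 1 = (4 * r^2 * (sin (pi * n * t))^2 + t^2) / t^2"
      using elim by (simp add: field_simps)
    then show ?case unfolding chord_def using elim by (simp add: real_sqrt_divide)
  qed
  ultimately show ?thesis by (auto intro: Lim_transform_eventually)
qed

text \<open>After division by \<open>t\<close> the numerator tends to \<open>c^2\<close> and the
  denominator to \<open>c\<close>, where \<open>c\<close> is the speed.\<close>

lemma chord_slope_tendsto:
  "(chord_slope r n \<longlongrightarrow> helix_speed r n) (at_right 0)"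
proof -
  let ?c = "helix_speed r n"
  have "((\<lambda>t. sin (2 * pi * n * t) / t) \<longlongrightarrow> 2 * pi * n) (at_right 0)"
    by (cases "n = 0"; real_asymp)
  then have "((\<lambda>t. (2 * pi * n * r^2 * (sin (2 * pi * n * t) / t) + 1) / (chord r n t / t))
      \<longlongrightarrow> (2 * pi * n * r^2 * (2 * pi * n) + 1) / ?c) (at_right 0)"
    using helix_speed_pos[of r n] by (intro tendsto_intros chord_over_tendsto) auto
  moreover have "(2 * pi * n * r^2 * (2 * pi * n) + 1) / ?c = ?c"
    using helix_speed_pos[of r n] helix_speed_sq[of r n] by (simp add: field_simps power2_eq_square)
  moreover have "\<forall>\<^sub>F t in at_right 0. (2 * pi * n * r^2 * (sin (2 * pi * n * t) / t) + 1) / (chord r n t / t) = chord_slope r n t"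
    using eventually_at_right_less[of 0]
  proof eventually_elim
    case (elim t)
    have "(2 * pi * n * r^2 * (sin (2 * pi * n * t) / t) + 1) / (chord r n t / t)
        = (t * (2 * pi * n * r^2 * (sin (2 * pi * n * t) / t) + 1)) / chord r n t"
      using elim by simp
    also have "t * (2 * pi * n * r^2 * (sin (2 * pi * n * t) / t) + 1) = 2 * pi * n * r^2 * sin (2 * pi * n * t) + t"
      using elim by (simp add: field_simps)
    finally show ?case unfolding chord_slope_def .
  qed
  ultimately show ?thesis by (auto intro: Lim_transform_eventually)
qed

lemma has_real_derivative_chord:
  assumes "t > 0"
  shows "(chord r n has_real_derivative chord_slope r n t) (at t)"
proof -
  have "4 * r^2 * (sin (pi * n * t))^2 + t^2 > 0" using assms by (simp add: add_nonneg_pos)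
  moreover have "sin (2 * pi * n * t) = 2 * sin (pi * n * t) * cos (pi * n * t)"
    using sin_double[of "pi * n * t"] by (simp add: mult.assoc)
  ultimately show ?thesis
    unfolding chord_def[abs_def] chord_slope_def
    by (auto intro!: derivative_eq_intros simp: field_simps power2_eq_square)
qed

text \<open>With \<open>D\<close> the chord length, \<open>D * D'\<close> is the numerator of
  \<open>chord_slope\<close>. Its derivative \<open>D'^2 + D * D''\<close> is the numerator of the
  Neumann kernel; division by \<open>D\<close> gives the claim.\<close>

lemma has_real_derivative_chord_slope:
  assumes "t > 0"
  shows "(chord_slope r n has_real_derivative neumann_kernel r n t - weber_kernel r n t) (at t)"
proof -
  have p: "chord r n t > 0" using assms by (simp add: chord_pos)
  show ?thesis
    unfolding chord_slope_def[abs_def]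
    by (rule derivative_eq_intros has_real_derivative_chord assms refl)+
      (use p assms in \<open>auto simp: neumann_kernel_def weber_kernel_def chord_slope_def field_simps power2_eq_square\<close>)
qed

lemma continuous_on_kernels:
  assumes "0 \<notin> S"
  shows "continuous_on S (neumann_kernel r n)" "continuous_on S (weber_kernel r n)"
proof -
  have ne: "\<forall>x\<in>S. chord r n x \<noteq> 0"
    using assms by auto
  show "continuous_on S (neumann_kernel r n)"
    unfolding neumann_kernel_def[abs_def] by (intro continuous_intros ne)
  show "continuous_on S (weber_kernel r n)"
    unfolding weber_kernel_def[abs_def] chord_slope_def[abs_def] by (intro continuous_intros ne)
qed

lemma measurable_chord [measurable]: "chord r n \<in> borel_measurable borel"
  unfolding chord_def[abs_def] by measurable

lemma measurable_kernels [measurable]: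
  "neumann_kernel r n \<in> borel_measurable borel" "weber_kernel r n \<in> borel_measurable borel"
  unfolding neumann_kernel_def[abs_def] weber_kernel_def[abs_def] chord_slope_def[abs_def] by measurable

lemma neumann_kernel_bound:
  assumes "\<epsilon> > 0" "chord r n t > \<epsilon>"
  shows "\<bar>neumann_kernel r n t\<bar> \<le> (helix_speed r n)^2 / \<epsilon>"
proof -
  have "\<bar>(2 * pi * n * r)^2 * cos (2 * pi * n * t) + 1\<bar> \<le> (2 * pi * n * r)^2 * \<bar>cos (2 * pi * n * t)\<bar> + 1"
    using abs_triangle_ineq[of "(2 * pi * n * r)^2 * cos (2 * pi * n * t)" 1] by (simp add: abs_mult)
  also have "\<dots> \<le> (helix_speed r n)^2"
    unfolding helix_speed_sq by (intro add_right_mono mult_left_le) auto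
  finally show ?thesis
    unfolding neumann_kernel_def abs_divide using assms by (intro frac_le) auto
qed

text \<open>The bound may blow up with \<open>\<epsilon>\<close>: it only serves to make the
  integrand bounded for each fixed cut-off.\<close>

lemma weber_kernel_bound:
  assumes "\<epsilon> > 0" "chord r n t > \<epsilon>"
  shows "\<bar>weber_kernel r n t\<bar> \<le> (2 * pi * \<bar>n\<bar> * r^2 / \<epsilon> + 1)^2 / \<epsilon>"
proof -
  have p: "chord r n t > 0" using assms by linarith
  have "\<bar>chord_slope r n t\<bar> \<le> \<bar>2 * pi * n * r^2 * sin (2 * pi * n * t)\<bar> / chord r n t + \<bar>t\<bar> / chord r n t"
    unfolding chord_slope_def abs_divide using p
    by (simp flip: add_divide_distrib add: divide_right_mono)
  also have "\<dots> \<le> 2 * pi * \<bar>n\<bar> * r^2 / \<epsilon> + 1"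
  proof (rule add_mono)
    show "\<bar>2 * pi * n * r^2 * sin (2 * pi * n * t)\<bar> / chord r n t \<le> 2 * pi * \<bar>n\<bar> * r^2 / \<epsilon>"
      using assms by (intro frac_le) (auto simp: abs_mult intro!: mult_left_mono mult_left_le)
    show "\<bar>t\<bar> / chord r n t \<le> 1" using p abs_le_chord[of t r n] by simp
  qed
  finally have "\<bar>chord_slope r n t\<bar>^2 \<le> (2 * pi * \<bar>n\<bar> * r^2 / \<epsilon> + 1)^2"
    by (rule power_mono) simp
  then show ?thesis
    unfolding weber_kernel_def abs_divide using assms by (intro frac_le) auto
qed

section \<open>From the cut-off double integrals to truncated integrals in one variable\<close>

lemma integral_stretch:
  fixes f :: "real \<Rightarrow> real"
  assumes "c > 0"
  shows "integral {c * a..c * b} f = c * integral {a..b} (\<lambda>x. f (c * x))"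
proof -
  have "(\<lambda>x. x / c) ` {c * a..c * b} = {a..b}"
    using image_divide_atLeastAtMost[of c "c * a" "c * b"] assms by simp
  then show ?thesis
    using integral_stretch_real[of c "c * a" "c * b" f] assms by (simp add: field_simps)
qed

text \<open>Extending the integrand by zero beyond the cut-off gives a bounded even function of
  \<open>s1 - s2\<close> on the full square. In the substitution \<open>s = c * t\<close> the
  factors \<open>c\<close> from the length element and from \<open>l * c - s\<close> cancel the
  division by \<open>c^2\<close>.\<close>

lemma integral_D_eps_helix:
  assumes K [measurable]: "K \<in> borel_measurable borel" and even: "\<And>t. K (- t) = K t"
    and bound: "\<And>t. chord r n t > \<epsilon> \<Longrightarrow> \<bar>K t\<bar> \<le> B" and "l > 0"
  shows "integral (D_eps (helix_gamma r n) (helix_len r l n) \<epsilon>)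
       (\<lambda>(s1, s2). K ((s1 - s2) / helix_speed r n) / (helix_speed r n)^2)
     = 2 * integral {0..l} (\<lambda>t. (l - t) * (if chord r n t > \<epsilon> then K t else 0))"
proof -
  define c where "c = helix_speed r n"
  have c: "c > 0" unfolding c_def by (rule helix_speed_pos)
  define k where "k = (\<lambda>t. if chord r n t > \<epsilon> then K t else 0)"
  define F where "F = (\<lambda>s. k (s / c) / c^2)"
  have [measurable]: "k \<in> borel_measurable borel" unfolding k_def by measurable
  have [measurable]: "F \<in> borel_measurable borel" unfolding F_def by measurable
  \<comment> \<open>The maximum with 0 covers the points where \<open>k\<close> is set to 0,
    whatever the sign of \<open>B\<close>.\<close>
  have kB: "\<bar>k t\<bar> \<le> max 0 B" for t using bound[of t] unfolding k_def by auto
  have "integral (D_eps (helix_gamma r n) (l * c) \<epsilon>) (\<lambda>(s1, s2). K ((s1 - s2) / c) / c^2)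
      = integral ({0..l * c} \<times> {0..l * c}) (\<lambda>z. if z \<in> D_eps (helix_gamma r n) (l * c) \<epsilon>
           then (case z of (s1, s2) \<Rightarrow> K ((s1 - s2) / c) / c^2) else 0)"
    unfolding Henstock_Kurzweil_Integration.integral_restrict_Int
    by (rule arg_cong2[where f = integral]) (auto simp: D_eps_def)
  also have "\<dots> = integral ({0..l * c} \<times> {0..l * c}) (\<lambda>(x, y). F (x - y))"
    by (rule Henstock_Kurzweil_Integration.integral_cong)
      (auto simp: D_eps_def F_def k_def dist_norm norm_helix_gamma_diff c_def split: if_splits)
  also have "\<dots> = 2 * integral {0..l * c} (\<lambda>s. (l * c - s) * F s)"
  proof (rule integral_square_difference[where B = "max 0 B / c^2"])
    show "\<bar>F x\<bar> \<le> max 0 B / c^2" for x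
      unfolding F_def abs_divide using kB by (simp add: divide_right_mono)
    show "F (- x) = F x" for x
      unfolding F_def k_def using even[of "x / c"] by simp
  qed (use c assms in auto)
  also have "integral {0..l * c} (\<lambda>s. (l * c - s) * F s) = c * integral {0..l} (\<lambda>t. (l * c - c * t) * F (c * t))"
    using integral_stretch[OF c, of 0 l "\<lambda>s. (l * c - s) * F s"] by (simp add: mult.commute)
  also have "\<dots> = integral {0..l} (\<lambda>t. c * ((l * c - c * t) * F (c * t)))"
    by simp
  also have "\<dots> = integral {0..l} (\<lambda>t. (l - t) * k t)"
    by (rule Henstock_Kurzweil_Integration.integral_cong)
      (use c in \<open>simp add: F_def field_simps power2_eq_square\<close>)
  finally show ?thesis unfolding c_def k_def helix_len_eq .
qed

text \<open>The intermediate value theorem yields \<open>\<tau>\<close>. Up to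
  \<open>\<tau>0\<close> strict monotonicity separates the two sides, and beyond it the chord is at
  least \<open>t > \<tau>0 > \<epsilon>\<close>, so the later oscillation of the chord never returns
  below the cut-off.\<close>

lemma chord_superlevel:
  assumes "n > 0" "0 < \<epsilon>" "\<epsilon> < \<tau>0" "\<tau>0 \<le> 1 / (2 * n)"
  obtains \<tau> where "0 < \<tau>" "\<tau> \<le> \<epsilon>" "chord r n \<tau> = \<epsilon>"
    "\<And>t. t \<ge> 0 \<Longrightarrow> chord r n t > \<epsilon> \<longleftrightarrow> t > \<tau>"
proof -
  have "\<tau>0 \<le> chord r n \<tau>0" using abs_le_chord[of \<tau>0 r n] by linarith
  then obtain \<tau> where \<tau>: "0 \<le> \<tau>" "\<tau> \<le> \<tau>0" "chord r n \<tau> = \<epsilon>"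
    using IVT'[of "chord r n" 0 \<epsilon> \<tau>0] assms by (auto intro: continuous_intros)
  have "\<tau> \<le> \<epsilon>" using abs_le_chord[of \<tau> r n] \<tau> by linarith
  have "chord r n t > \<epsilon> \<longleftrightarrow> t > \<tau>" if "t \<ge> 0" for t
  proof (cases "t \<le> \<tau>0")
    case True
    then show ?thesis
      using chord_strict_mono[of n t \<tau> r] chord_strict_mono[of n \<tau> t r] assms \<tau> that
      by (cases t \<tau> rule: linorder_cases) auto
  next
    case False
    then show ?thesis using abs_le_chord[of t r n] assms \<tau> by linarith
  qed
  moreover have "\<tau> \<noteq> 0" using \<tau>(3) assms by auto
  ultimately show thesis using \<tau> \<open>\<tau> \<le> \<epsilon>\<close> by (intro that[of \<tau>]) linarith+
qed

text \<open>Substituting \<open>\<epsilon> = chord r n \<tau>\<close> turns the cut-off by distance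
  into a cut-off by height difference, and \<open>ln \<epsilon>\<close> into the logarithm in the
  hypothesis on the limit. The folded square contributes the factor 2 that changes
  \<open>4 * pi\<close> into \<open>2 * pi\<close>.\<close>

lemma regularization_tendsto:
  assumes K: "K \<in> borel_measurable borel" "\<And>t. K (- t) = K t"
    and bound: "\<And>\<epsilon> t. \<epsilon> > 0 \<Longrightarrow> chord r n t > \<epsilon> \<Longrightarrow> \<bar>K t\<bar> \<le> B \<epsilon>"
    and "n > 0" "l > 0"
    and lim: "((\<lambda>\<tau>. integral {\<tau>..l} (\<lambda>t. (l - t) * K t) + helix_len r l n * ln (chord r n \<tau>)) \<longlongrightarrow> A) (at_right 0)"
  shows "((\<lambda>\<epsilon>. \<mu> / (4 * pi) * integral (D_eps (helix_gamma r n) (helix_len r l n) \<epsilon>)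
        (\<lambda>(s1, s2). K ((s1 - s2) / helix_speed r n) / (helix_speed r n)^2)
      + \<mu> * helix_len r l n / (2 * pi) * ln \<epsilon>) \<longlongrightarrow> \<mu> / (2 * pi) * A) (at_right 0)"
proof -
  define \<tau>0 where "\<tau>0 = min l (1 / (2 * n))"
  have \<tau>0: "\<tau>0 > 0" "\<tau>0 \<le> l" "\<tau>0 \<le> 1 / (2 * n)" using assms unfolding \<tau>0_def by auto
  have "\<exists>\<tau>. 0 < \<tau> \<and> \<tau> \<le> \<epsilon> \<and> chord r n \<tau> = \<epsilon> \<and> (\<forall>t\<ge>0. chord r n t > \<epsilon> \<longleftrightarrow> t > \<tau>)"
    if "0 < \<epsilon>" "\<epsilon> < \<tau>0" for \<epsilon>
    using chord_superlevel[OF \<open>n > 0\<close> that \<tau>0(3)] by metis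
  then obtain \<tau> where \<tau>: "\<And>\<epsilon>. 0 < \<epsilon> \<Longrightarrow> \<epsilon> < \<tau>0 \<Longrightarrow> 0 < \<tau> \<epsilon> \<and> \<tau> \<epsilon> \<le> \<epsilon> \<and> chord r n (\<tau> \<epsilon>) = \<epsilon> \<and> (\<forall>t\<ge>0. chord r n t > \<epsilon> \<longleftrightarrow> t > \<tau> \<epsilon>)"
    by metis
  have ev: "\<forall>\<^sub>F \<epsilon> in at_right 0. 0 < \<epsilon> \<and> \<epsilon> < \<tau>0"
    using \<tau>0(1) by (auto simp: eventually_at_right_field)
  have "filterlim \<tau> (at_right 0) (at_right 0)"
  proof (rule tendsto_imp_filterlim_at_right)
    show "(\<tau> \<longlongrightarrow> 0) (at_right 0)"
    proof (rule tendsto_sandwich)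
      show "\<forall>\<^sub>F \<epsilon> in at_right 0. 0 \<le> \<tau> \<epsilon>" using ev by eventually_elim (use \<tau> in force)
      show "\<forall>\<^sub>F \<epsilon> in at_right 0. \<tau> \<epsilon> \<le> \<epsilon>" using ev by eventually_elim (use \<tau> in force)
    qed auto
    show "\<forall>\<^sub>F \<epsilon> in at_right 0. \<tau> \<epsilon> > 0" using ev by eventually_elim (use \<tau> in force)
  qed
  from filterlim_compose[OF lim this]
  have "((\<lambda>\<epsilon>. \<mu> / (2 * pi) * (integral {\<tau> \<epsilon>..l} (\<lambda>t. (l - t) * K t) + helix_len r l n * ln (chord r n (\<tau> \<epsilon>))))
     \<longlongrightarrow> \<mu> / (2 * pi) * A) (at_right 0)"
    by (intro tendsto_mult_left)
  then show ?thesis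
  proof (rule Lim_transform_eventually)
    show "\<forall>\<^sub>F \<epsilon> in at_right 0. \<mu> / (2 * pi) * (integral {\<tau> \<epsilon>..l} (\<lambda>t. (l - t) * K t) + helix_len r l n * ln (chord r n (\<tau> \<epsilon>)))
      = \<mu> / (4 * pi) * integral (D_eps (helix_gamma r n) (helix_len r l n) \<epsilon>)
        (\<lambda>(s1, s2). K ((s1 - s2) / helix_speed r n) / (helix_speed r n)^2)
      + \<mu> * helix_len r l n / (2 * pi) * ln \<epsilon>"
      using ev
    proof eventually_elim
      case (elim \<epsilon>)
      note t = \<tau>[of \<epsilon>]
      have "integral (D_eps (helix_gamma r n) (helix_len r l n) \<epsilon>)
        (\<lambda>(s1, s2). K ((s1 - s2) / helix_speed r n) / (helix_speed r n)^2)
        = 2 * integral {0..l} (\<lambda>t. (l - t) * (if chord r n t > \<epsilon> then K t else 0))"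
        using elim K bound \<open>l > 0\<close> by (intro integral_D_eps_helix[where B = "B \<epsilon>"]) auto
      also have "integral {0..l} (\<lambda>t. (l - t) * (if chord r n t > \<epsilon> then K t else 0))
        = integral {0..l} (\<lambda>t. if t \<in> {\<tau> \<epsilon>..l} then (l - t) * K t else 0)"
        \<comment> \<open>The region is open at \<open>\<tau> \<epsilon>\<close> because the
          distance condition is strict; a single point does not change the integral.\<close>
        by (rule integral_spike[where S = "{\<tau> \<epsilon>}"]) (use elim t in auto)
      also have "\<dots> = integral {\<tau> \<epsilon>..l} (\<lambda>t. (l - t) * K t)"
        unfolding Henstock_Kurzweil_Integration.integral_restrict_Int
        by (rule arg_cong2[where f = integral]) (use elim t in auto)
      finally show ?case
        using elim conjunct1[OF conjunct2[OF conjunct2[OF t]]] by (simp add: field_simps del: Henstock_Kurzweil_Integration.integral_mult_right)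
    qed
  qed
qed

lemma neumann_reg_helix:
  "neumann_reg \<mu> (helix_gamma r n) L = (\<lambda>\<epsilon>. \<mu> / (4 * pi) * integral (D_eps (helix_gamma r n) L \<epsilon>)
        (\<lambda>(s1, s2). neumann_kernel r n ((s1 - s2) / helix_speed r n) / (helix_speed r n)^2)
      + \<mu> * L / (2 * pi) * ln \<epsilon>)"
  by (rule ext) (simp only: neumann_reg_def neumann_integrand_helix)

lemma weber_reg_helix:
  "weber_reg \<mu> (helix_gamma r n) L = (\<lambda>\<epsilon>. \<mu> / (4 * pi) * integral (D_eps (helix_gamma r n) L \<epsilon>)
        (\<lambda>(s1, s2). weber_kernel r n ((s1 - s2) / helix_speed r n) / (helix_speed r n)^2)
      + \<mu> * L / (2 * pi) * ln \<epsilon>)"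
  by (rule ext) (simp only: weber_reg_def Let_def weber_integrand_helix)

text \<open>For \<open>0 \<le> x < 1\<close> the derivative \<open>x * sin x\<close> of
  \<open>sin x - x * cos x\<close> is nonnegative, so \<open>x * cos x \<le> sin x\<close>; squaring
  gives \<open>x^2 - (sin x)^2 \<le> x^2 * (sin x)^2 \<le> x^4\<close>. For
  \<open>\<bar>x\<bar> \<ge> 1\<close> already \<open>x^2 \<le> x^4\<close>.\<close>

lemma sq_minus_sin_sq_le: "x^2 - (sin x)^2 \<le> x^4" for x :: real
proof -
  have main: "x^2 - (sin x)^2 \<le> x^4" if "x \<ge> 0" "x < 1" for x :: real
  proof -
    have "(\<lambda>x. sin x - x * cos x) 0 \<le> (\<lambda>x. sin x - x * cos x) x"
    proof (rule DERIV_nonneg_imp_nondecreasing[OF that(1)])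
      fix y assume y: "0 \<le> y" "y \<le> x"
      have "((\<lambda>x. sin x - x * cos x) has_real_derivative y * sin y) (at y)"
        by (auto intro!: derivative_eq_intros)
      moreover have "sin y \<ge> 0" using y that pi_gt3 by (intro sin_ge_zero) linarith+
      ultimately show "\<exists>d. ((\<lambda>x. sin x - x * cos x) has_real_derivative d) (at y) \<and> 0 \<le> d"
        using y by (intro exI[of _ "y * sin y"]) auto
    qed
    then have "x * cos x \<le> sin x" by simp
    moreover have "cos x \<ge> 0" using that pi_gt3 by (intro cos_ge_zero) linarith+
    ultimately have "(x * cos x)^2 \<le> (sin x)^2" using that by (intro power_mono) auto
    moreover have "(sin x)^2 \<le> x^2"
      using abs_sin_x_le_abs_x[of x] by (simp add: abs_le_square_iff)
    then have "x^2 * (sin x)^2 \<le> x^2 * x^2" by (rule mult_left_mono) simp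
    moreover have "(x * cos x)^2 = x^2 - x^2 * (sin x)^2"
      by (simp add: power_mult_distrib cos_squared_eq algebra_simps)
    ultimately show ?thesis by (simp add: power4_eq_xxxx power2_eq_square)
  qed
  show ?thesis
  proof (cases "\<bar>x\<bar> < 1")
    case True
    then show ?thesis using main[of "\<bar>x\<bar>"] by (cases "x \<ge> 0") (auto simp: abs_if)
  next
    case False
    then have "1 \<le> x^2" using abs_square_less_1[of x] by linarith
    then have "x^2 * 1 \<le> x^2 * x^2" by (intro mult_left_mono) auto
    then have "x^2 \<le> x^4" by (simp flip: power_add)
    then show ?thesis using zero_le_power2[of "sin x"] by linarith
  qed
qed

subsection \<open>Removing the cut-off\<close>

text \<open>The weighted kernel minus its singular part at 0. The difference stays bounded on
  \<open>(0, l]\<close>, so it can be integrated from 0.\<close>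

definition neumann_remainder :: "real \<Rightarrow> real \<Rightarrow> real \<Rightarrow> real \<Rightarrow> real" where
  "neumann_remainder r l n t = (l - t) * neumann_kernel r n t - helix_len r l n / t"

text \<open>Writing \<open>K\<close> for the kernel, the remainder is
  \<open>l * (K - c / t) - t * K\<close>. The essential term \<open>c^2 / D - c / t\<close> is
  controlled by \<open>(c * t)^2 - D^2 = 4 * r^2 * ((pi * n * t)^2 - s)\<close>, which is of fourth
  order in \<open>t\<close>. The constant \<open>\<kappa>\<close> stays free:
  \<open>\<kappa> = 1\<close> suffices for integrability, while \<open>\<kappa> = 4 * r * n\<close>
  gives the right growth in \<open>n\<close> near zero.\<close>

lemma neumann_remainder_bound:
  assumes t: "0 < t" "t \<le> l" and \<kappa>: "\<kappa> > 0" "\<kappa> * t \<le> chord r n t"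
  shows "\<bar>neumann_remainder r l n t\<bar> \<le> (helix_speed r n)^2 / \<kappa>
    + l / \<kappa> * (2 * (2 * pi * n * r)^2 * (pi * n)^2 + 4 * r^2 * (pi * n)^4) * t"
proof -
  define c where "c = helix_speed r n"
  define D where "D = chord r n t"
  define a where "a = 2 * pi * n * r"
  define s where "s = (sin (pi * n * t))^2"
  have c: "c > 0" unfolding c_def by (rule helix_speed_pos)
  have D: "D > 0" unfolding D_def using t by (simp add: chord_pos)
  have c2: "c^2 = a^2 + 1" unfolding c_def a_def by (rule helix_speed_sq)
  have D2: "D^2 = 4 * r^2 * s + t^2" unfolding D_def s_def by (rule chord_sq)
  have Dc: "D \<le> c * t" unfolding D_def c_def using chord_le_speed[of r n t] t by simp
  have s: "0 \<le> s" "s \<le> 1" "s \<le> (pi * n * t)^2" "(pi * n * t)^2 - s \<le> (pi * n * t)^4"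
    unfolding s_def using abs_sin_x_le_abs_x[of "pi * n * t"] sq_minus_sin_sq_le[of "pi * n * t"]
    by (auto simp: abs_le_square_iff abs_square_le_1)
  have cs: "cos (2 * pi * n * t) = 1 - 2 * s"
    unfolding s_def using cos_double_sin[of "pi * n * t"] by (simp add: mult.assoc)
  have K: "neumann_kernel r n t = (c^2 - 2 * a^2 * s) / D"
    unfolding neumann_kernel_def cs c2 a_def[symmetric] D_def by (simp add: algebra_simps)
  have inv: "1 / D \<le> 1 / (\<kappa> * t)" using \<kappa> t unfolding D_def by (intro frac_le) auto
  have le: "X / D \<le> X / (\<kappa> * t)" if "X \<ge> 0" for X
    using mult_left_mono[OF inv that] by simp
  have "a^2 * s \<le> a^2" using s by (intro mult_left_le) auto
  then have "\<bar>c^2 - 2 * a^2 * s\<bar> \<le> c^2" using s c2 zero_le_power2[of a] by (simp add: abs_if)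
  then have "\<bar>neumann_kernel r n t\<bar> \<le> c^2 / D"
    unfolding K abs_divide using D by (simp add: divide_right_mono)
  also have "\<dots> \<le> c^2 / (\<kappa> * t)" by (rule le) simp
  finally have "t * \<bar>neumann_kernel r n t\<bar> \<le> t * (c^2 / (\<kappa> * t))" using t by (intro mult_left_mono) auto
  then have 1: "\<bar>t * neumann_kernel r n t\<bar> \<le> c^2 / \<kappa>" using t \<kappa> by (simp add: abs_mult)
  have 2: "2 * a^2 * s / D \<le> 2 * a^2 * (pi * n)^2 / \<kappa> * t"
  proof -
    have "2 * a^2 * s / D \<le> 2 * a^2 * (pi * n * t)^2 / D"
      using D s by (intro divide_right_mono mult_left_mono) auto
    also have "\<dots> \<le> 2 * a^2 * (pi * n * t)^2 / (\<kappa> * t)" by (rule le) simp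
    also have "\<dots> = 2 * a^2 * (pi * n)^2 / \<kappa> * t"
      using t \<kappa> by (simp add: field_simps power2_eq_square)
    finally show ?thesis .
  qed
  have 3: "c^2 / D - c / t \<le> 4 * r^2 * (pi * n)^4 / \<kappa> * t"
  proof -
    have "(c * t)^2 - D^2 = 4 * r^2 * ((pi * n * t)^2 - s)"
      unfolding D2 power_mult_distrib c2 a_def by (simp add: algebra_simps)
    also have "\<dots> \<le> 4 * r^2 * (pi * n * t)^4" using s by (intro mult_left_mono) auto
    finally have "(c * t - D) * (c * t + D) \<le> 4 * r^2 * (pi * n * t)^4"
      by (simp add: power2_eq_square algebra_simps)
    \<comment> \<open>Since \<open>c * t - D\<close> is nonnegative, \<open>D\<close> may be dropped
      from the second factor.\<close>
    moreover have "(c * t - D) * (c * t) \<le> (c * t - D) * (c * t + D)"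
      using Dc D by (intro mult_left_mono) auto
    ultimately have "c * (c * t - D) \<le> 4 * r^2 * (pi * n * t)^4 / t"
      using t by (simp add: field_simps)
    then have "c * (c * t - D) / (D * t) \<le> 4 * r^2 * (pi * n * t)^4 / t / (D * t)"
      using D t by (intro divide_right_mono) auto
    also have "\<dots> = (4 * r^2 * (pi * n * t)^4 / t / t) / D" by simp
    also have "\<dots> \<le> (4 * r^2 * (pi * n * t)^4 / t / t) / (\<kappa> * t)" by (rule le) (use t in simp)
    also have "\<dots> = 4 * r^2 * (pi * n)^4 / \<kappa> * t"
      using t \<kappa> by (simp add: field_simps power4_eq_xxxx power2_eq_square)
    also have "c * (c * t - D) / (D * t) = c^2 / D - c / t"
      using D t by (simp add: field_simps power2_eq_square)
    finally show ?thesis .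
  qed
  have 4: "c^2 / D - c / t \<ge> 0"
  proof -
    have "c * D \<le> c * (c * t)" using c Dc by (intro mult_left_mono) auto
    then show ?thesis using D t by (simp add: field_simps power2_eq_square)
  qed
  have 5: "2 * a^2 * s / D \<ge> 0" using s D by simp
  have "neumann_kernel r n t - c / t = (c^2 / D - c / t) - 2 * a^2 * s / D"
    unfolding K by (simp add: diff_divide_distrib)
  with 2 3 4 5 have "\<bar>neumann_kernel r n t - c / t\<bar> \<le> 2 * a^2 * (pi * n)^2 / \<kappa> * t + 4 * r^2 * (pi * n)^4 / \<kappa> * t"
    by linarith
  then have "l * \<bar>neumann_kernel r n t - c / t\<bar> \<le> l * (2 * a^2 * (pi * n)^2 / \<kappa> * t + 4 * r^2 * (pi * n)^4 / \<kappa> * t)"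
    using t by (intro mult_left_mono) auto
  moreover have "neumann_remainder r l n t = l * (neumann_kernel r n t - c / t) - t * neumann_kernel r n t"
    unfolding neumann_remainder_def helix_len_eq c_def by (simp add: algebra_simps)
  then have "\<bar>neumann_remainder r l n t\<bar> \<le> l * \<bar>neumann_kernel r n t - c / t\<bar> + \<bar>t * neumann_kernel r n t\<bar>"
    using abs_triangle_ineq4[of "l * (neumann_kernel r n t - c / t)" "t * neumann_kernel r n t"] t by (simp add: abs_mult)
  moreover have "l * (2 * a^2 * (pi * n)^2 / \<kappa> * t + 4 * r^2 * (pi * n)^4 / \<kappa> * t)
      = l / \<kappa> * (2 * a^2 * (pi * n)^2 + 4 * r^2 * (pi * n)^4) * t"
    using \<kappa> by (simp add: field_simps)
  ultimately show ?thesis using 1 unfolding a_def c_def by linarith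
qed

lemma neumann_remainder_integrable:
  assumes "l > 0"
  shows "neumann_remainder r l n integrable_on {0..l}"
proof -
  define C where "C = 2 * (2 * pi * n * r)^2 * (pi * n)^2 + 4 * r^2 * (pi * n)^4"
  have C: "C \<ge> 0" unfolding C_def by simp
  show ?thesis
  proof (rule measurable_bounded_by_integrable_imp_integrable_real)
    have "neumann_remainder r l n \<in> borel_measurable borel"
      unfolding neumann_remainder_def[abs_def] by measurable
    then show "neumann_remainder r l n \<in> borel_measurable (lebesgue_on {0..l})"
      by (intro measurable_restrict_space1 measurable_completion) simp
    show "\<bar>neumann_remainder r l n t\<bar> \<le> (helix_speed r n)^2 + l * C * t" if "t \<in> {0..l}" for t
    proof (cases "t = 0")
      case True
      \<comment> \<open>At \<open>t = 0\<close> both quotients are 0 by convention, and so is the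
        remainder.\<close>
      then show ?thesis by (simp add: neumann_remainder_def neumann_kernel_def)
    next
      case False
      then show ?thesis
        using neumann_remainder_bound[of t l 1 r n] that abs_le_chord[of t r n] unfolding C_def by simp
    qed
    show "(\<lambda>t. (helix_speed r n)^2 + l * C * t) integrable_on {0..l}"
      by (intro integrable_continuous_real continuous_intros)
  qed simp
qed

lemma has_integral_inverse:
  fixes a b :: real
  assumes "0 < a" "a \<le> b"
  shows "((\<lambda>t. c / t) has_integral c * (ln b - ln a)) {a..b}"
proof -
  have "((\<lambda>t. 1 / t) has_integral (ln b - ln a)) {a..b}"
  proof (rule fundamental_theorem_of_calculus)
    fix t assume "t \<in> {a..b}"
    then have "(ln has_real_derivative 1 / t) (at t)" using assms by (auto intro!: derivative_eq_intros)
    then show "(ln has_vector_derivative 1 / t) (at t within {a..b})"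
      by (simp add: has_real_derivative_iff_has_vector_derivative has_vector_derivative_at_within)
  qed (use assms in auto)
  from has_integral_mult_right[OF this, of c] show ?thesis by simp
qed

text \<open>Finite part of the weighted kernel integral: \<open>ln l\<close> comes from integrating
  the singular part up to \<open>l\<close>, and the logarithm of the speed from the ratio of chord
  and height difference at the cut-off.\<close>

definition neumann_energy :: "real \<Rightarrow> real \<Rightarrow> real \<Rightarrow> real" where
  "neumann_energy r l n = integral {0..l} (neumann_remainder r l n)
     + helix_len r l n * (ln l + ln (helix_speed r n))"

lemma integrable_weighted_kernels:
  assumes "\<tau> > 0"
  shows "(\<lambda>t. (l - t) * neumann_kernel r n t) integrable_on {\<tau>..l}"
    "(\<lambda>t. (l - t) * weber_kernel r n t) integrable_on {\<tau>..l}"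
  using assms by (auto intro!: integrable_continuous_real continuous_intros continuous_on_kernels)

lemma integral_neumann_remainder:
  assumes "0 < \<tau>" "\<tau> \<le> l"
  shows "integral {\<tau>..l} (neumann_remainder r l n)
    = integral {\<tau>..l} (\<lambda>t. (l - t) * neumann_kernel r n t) - helix_len r l n * (ln l - ln \<tau>)"
proof -
  have "((\<lambda>t. (l - t) * neumann_kernel r n t - helix_len r l n / t) has_integral
      integral {\<tau>..l} (\<lambda>t. (l - t) * neumann_kernel r n t) - helix_len r l n * (ln l - ln \<tau>)) {\<tau>..l}"
    by (intro has_integral_diff has_integral_inverse integrable_integral integrable_weighted_kernels assms)
  then show ?thesis unfolding neumann_remainder_def[abs_def] by (rule integral_unique)
qed

text \<open>The singular part integrates to \<open>helix_len r l n * (ln l - ln \<tau>)\<close>;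
  together with the counter term only \<open>ln (chord r n \<tau> / \<tau>)\<close> remains, which
  converges.\<close>

lemma neumann_truncated_tendsto:
  assumes "l > 0"
  shows "((\<lambda>\<tau>. integral {\<tau>..l} (\<lambda>t. (l - t) * neumann_kernel r n t)
      + helix_len r l n * ln (chord r n \<tau>)) \<longlongrightarrow> neumann_energy r l n) (at_right 0)"
proof -
  have "continuous_on {0..l} (\<lambda>x. integral {x..l} (neumann_remainder r l n))"
    by (rule indefinite_integral_continuous_1'[OF neumann_remainder_integrable[OF assms]])
  then have "((\<lambda>x. integral {x..l} (neumann_remainder r l n)) \<longlongrightarrow> integral {0..l} (neumann_remainder r l n)) (at_right 0)"
    using assms by (force simp: continuous_on_def at_within_Icc_at_right dest!: bspec[of _ _ 0])
  then have "((\<lambda>\<tau>. integral {\<tau>..l} (neumann_remainder r l n)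
      + helix_len r l n * (ln l + ln (chord r n \<tau> / \<tau>))) \<longlongrightarrow> neumann_energy r l n) (at_right 0)"
    unfolding neumann_energy_def
    using helix_speed_pos[of r n] by (intro tendsto_intros chord_over_tendsto) auto
  then show ?thesis
  proof (rule Lim_transform_eventually)
    have "\<forall>\<^sub>F \<tau> in at_right 0. 0 < \<tau> \<and> \<tau> < l"
      using assms by (auto simp: eventually_at_right_field)
    then show "\<forall>\<^sub>F \<tau> in at_right 0. integral {\<tau>..l} (neumann_remainder r l n)
        + helix_len r l n * (ln l + ln (chord r n \<tau> / \<tau>))
      = integral {\<tau>..l} (\<lambda>t. (l - t) * neumann_kernel r n t) + helix_len r l n * ln (chord r n \<tau>)"
    proof eventually_elim
      case (elim \<tau>)
      then show ?case
        using chord_pos[of \<tau> r n] by (simp add: integral_neumann_remainder ln_div algebra_simps)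
    qed
  qed
qed

text \<open>As the kernels differ by \<open>D''\<close>, the function
  \<open>?G = (l - t) * D' + D\<close> is an antiderivative of the weighted difference. Its boundary
  values are \<open>D(l)\<close> at \<open>l\<close> and, in the limit,
  \<open>l * c = helix_len r l n\<close> at 0.\<close>

lemma weber_truncated_tendsto:
  assumes "l > 0"
  shows "((\<lambda>\<tau>. integral {\<tau>..l} (\<lambda>t. (l - t) * weber_kernel r n t)
      + helix_len r l n * ln (chord r n \<tau>))
      \<longlongrightarrow> neumann_energy r l n - (chord r n l - helix_len r l n)) (at_right 0)"
proof -
  let ?G = "\<lambda>t. (l - t) * chord_slope r n t + chord r n t"
  have G: "integral {\<tau>..l} (\<lambda>t. (l - t) * neumann_kernel r n t)
      - integral {\<tau>..l} (\<lambda>t. (l - t) * weber_kernel r n t) = chord r n l - ?G \<tau>"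
    if "0 < \<tau>" "\<tau> < l" for \<tau>
  proof -
    have "((\<lambda>t. (l - t) * neumann_kernel r n t - (l - t) * weber_kernel r n t) has_integral (?G l - ?G \<tau>)) {\<tau>..l}"
    proof (rule fundamental_theorem_of_calculus)
      fix t assume "t \<in> {\<tau>..l}"
      then have "t > 0" using that by simp
      then have "(?G has_real_derivative
          ((l - t) * neumann_kernel r n t - (l - t) * weber_kernel r n t)) (at t)"
        by (auto intro!: derivative_eq_intros has_real_derivative_chord has_real_derivative_chord_slope
            simp: algebra_simps)
      then show "(?G has_vector_derivative
          ((l - t) * neumann_kernel r n t - (l - t) * weber_kernel r n t)) (at t within {\<tau>..l})"
        by (simp add: has_real_derivative_iff_has_vector_derivative has_vector_derivative_at_within)
    qed (use that in simp)
    then have "integral {\<tau>..l} (\<lambda>t. (l - t) * neumann_kernel r n t - (l - t) * weber_kernel r n t) = ?G l - ?G \<tau>"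
      by (rule integral_unique)
    then show ?thesis
      using that by (simp add: Henstock_Kurzweil_Integration.integral_diff integrable_weighted_kernels)
  qed
  have chord0: "(chord r n \<longlongrightarrow> 0) (at_right 0)"
  proof -
    have "isCont (chord r n) 0"
      using continuous_on_chord[of UNIV r n] by (simp add: continuous_on_eq_continuous_at)
    then show ?thesis by (simp add: isCont_def filterlim_at_split)
  qed
  have "((\<lambda>\<tau>. (integral {\<tau>..l} (\<lambda>t. (l - t) * neumann_kernel r n t) + helix_len r l n * ln (chord r n \<tau>))
      - (chord r n l - ?G \<tau>)) \<longlongrightarrow> neumann_energy r l n - (chord r n l - ((l - 0) * helix_speed r n + 0))) (at_right 0)"
    by (intro tendsto_diff[OF neumann_truncated_tendsto[OF assms]] tendsto_intros chord_slope_tendsto chord0)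
  then have "((\<lambda>\<tau>. (integral {\<tau>..l} (\<lambda>t. (l - t) * neumann_kernel r n t) + helix_len r l n * ln (chord r n \<tau>))
      - (chord r n l - ?G \<tau>)) \<longlongrightarrow> neumann_energy r l n - (chord r n l - helix_len r l n)) (at_right 0)"
    by (simp add: helix_len_eq)
  then show ?thesis
  proof (rule Lim_transform_eventually)
    have "\<forall>\<^sub>F \<tau> in at_right 0. 0 < \<tau> \<and> \<tau> < l"
      using assms by (auto simp: eventually_at_right_field)
    then show "\<forall>\<^sub>F \<tau> in at_right 0. (integral {\<tau>..l} (\<lambda>t. (l - t) * neumann_kernel r n t) + helix_len r l n * ln (chord r n \<tau>))
      - (chord r n l - ?G \<tau>) = integral {\<tau>..l} (\<lambda>t. (l - t) * weber_kernel r n t)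
      + helix_len r l n * ln (chord r n \<tau>)"
      by eventually_elim (use G in force)
  qed
qed

lemma neumann_reg_tendsto:
  assumes "l > 0" "n > 0"
  shows "(neumann_reg \<mu> (helix_gamma r n) (helix_len r l n)
    \<longlongrightarrow> \<mu> / (2 * pi) * neumann_energy r l n) (at_right 0)"
  unfolding neumann_reg_helix
  by (rule regularization_tendsto[OF _ _ neumann_kernel_bound assms(2,1) neumann_truncated_tendsto])
    (use assms in auto)

lemma weber_reg_tendsto:
  assumes "l > 0" "n > 0"
  shows "(weber_reg \<mu> (helix_gamma r n) (helix_len r l n)
    \<longlongrightarrow> \<mu> / (2 * pi) * (neumann_energy r l n - (chord r n l - helix_len r l n))) (at_right 0)"
  unfolding weber_reg_helix
  by (rule regularization_tendsto[OF _ _ weber_kernel_bound assms(2,1) weber_truncated_tendsto])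
    (use assms in auto)

lemma H_N_eq:
  assumes "l > 0" "n > 0"
  shows "H_N \<mu> r l n = \<mu> / (2 * pi) * neumann_energy r l n"
  unfolding H_N_def by (rule tendsto_Lim[OF _ neumann_reg_tendsto[OF assms]]) simp

lemma H_W_eq:
  assumes "l > 0" "n > 0"
  shows "H_W \<mu> r l n = \<mu> / (2 * pi) * (neumann_energy r l n - (chord r n l - helix_len r l n))"
  unfolding H_W_def by (rule tendsto_Lim[OF _ weber_reg_tendsto[OF assms]]) simp

subsection \<open>Many turns\<close>

text \<open>Jordan's inequality: on \<open>[0, pi/2]\<close> the concave sine lies above its secant.
  Squaring admits negative arguments.\<close>

lemma jordan_sin_sq:
  fixes x :: real
  assumes "\<bar>x\<bar> \<le> pi / 2"
  shows "(2 * x / pi)^2 \<le> (sin x)^2"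
proof -
  have *: "2 * x / pi \<le> sin x" if "0 \<le> x" "x \<le> pi / 2" for x
  proof -
    have cvx: "convex_on {0..pi/2} (\<lambda>x. - sin x)"
    proof (rule f''_ge0_imp_convex[where f' = "\<lambda>x. - cos x" and f'' = sin])
      show "0 \<le> sin x" if "x \<in> {0..pi/2}" for x
        using that pi_ge_zero by (intro sin_ge_zero) auto
    qed (auto intro!: derivative_eq_intros)
    have u: "2 * x / pi \<le> 1" "0 \<le> 2 * x / pi" using that by (auto simp: field_simps)
    have e: "(1 - 2 * x / pi) *\<^sub>R 0 + (2 * x / pi) *\<^sub>R (pi / 2) = x" by simp
    show ?thesis
      using convex_onD[OF cvx u(2,1), of 0 "pi/2"] e by simp
  qed
  have "2 * \<bar>x\<bar> / pi \<le> sin \<bar>x\<bar>" using *[of "\<bar>x\<bar>"] assms by simp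
  then have "(2 * \<bar>x\<bar> / pi)^2 \<le> (sin \<bar>x\<bar>)^2" by (rule power_mono) simp
  then show ?thesis by (auto simp: abs_if split: if_splits)
qed

text \<open>Starting half a turn away from 0 avoids the singularity and leaves periods of length
  \<open>1 / n\<close> centred at the positive multiples of \<open>1 / n\<close>, where the chord
  can be close to its minimum \<open>t\<close>.\<close>

definition oscillatory_part :: "real \<Rightarrow> real \<Rightarrow> real \<Rightarrow> real" where
  "oscillatory_part r l n = integral {1 / (2 * n)..l} (\<lambda>t. (l - t) * cos (2 * pi * n * t) / chord r n t)"

text \<open>Jordan's inequality for the sine term gives a lower bound that grows with
  \<open>n\<close>, much stronger than \<open>t \<le> chord r n t\<close> when there are many
  turns.\<close>

lemma chord_ge_near_zero:
  assumes "n > 0" "0 \<le> t" "t \<le> 1 / (2 * n)" "r > 0"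
  shows "4 * r * n * t \<le> chord r n t"
proof (rule power2_le_imp_le)
  have "pi * n * t \<le> pi / 2"
    using assms(1) mult_left_mono[OF assms(3), of "pi * n"] by simp
  then have "(2 * (pi * n * t) / pi)^2 \<le> (sin (pi * n * t))^2"
    using assms by (intro jordan_sin_sq) simp
  then have "4 * r^2 * (2 * n * t)^2 \<le> 4 * r^2 * (sin (pi * n * t))^2"
    by (intro mult_left_mono) (simp_all add: mult.assoc)
  moreover have "(4 * r * n * t)^2 = 4 * r^2 * (2 * n * t)^2" by (simp add: power_mult_distrib)
  ultimately show "(4 * r * n * t)^2 \<le> (chord r n t)^2"
    unfolding chord_sq using zero_le_power2[of t] by linarith
qed simp

text \<open>Above \<open>h\<close> the kernel is split at the summand 1 of its numerator; the
  logarithms of \<open>neumann_energy\<close> and of the singular part over \<open>{h..l}\<close>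
  combine to \<open>ln (c * h)\<close>.\<close>

lemma neumann_energy_split:
  fixes n :: real
  assumes "r > 0" "l > 0" "n > 0" "n > 1 / (2 * l)"
  defines "h \<equiv> 1 / (2 * n)" and "c \<equiv> helix_speed r n"
  shows "neumann_energy r l n = (2 * pi * n * r)^2 * oscillatory_part r l n
     + integral {0..h} (neumann_remainder r l n) + integral {h..l} (\<lambda>t. (l - t) / chord r n t)
     + l * c * ln (c * h)"
proof -
  have h: "0 < h" "h \<le> l" unfolding h_def using assms(2-4) by (auto simp: field_simps)
  have c: "c > 0" unfolding c_def by (rule helix_speed_pos)
  have ne: "\<forall>t\<in>{h..l}. chord r n t \<noteq> 0" using h by auto
  have i1: "(\<lambda>t. (l - t) * cos (2 * pi * n * t) / chord r n t) integrable_on {h..l}"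
    by (intro integrable_continuous_real continuous_intros ne)
  have i2: "(\<lambda>t. (l - t) / chord r n t) integrable_on {h..l}"
    by (intro integrable_continuous_real continuous_intros ne)
  have "((\<lambda>t. (2 * pi * n * r)^2 * ((l - t) * cos (2 * pi * n * t) / chord r n t) + (l - t) / chord r n t)
     has_integral (2 * pi * n * r)^2 * oscillatory_part r l n + integral {h..l} (\<lambda>t. (l - t) / chord r n t)) {h..l}"
    unfolding oscillatory_part_def h_def[symmetric]
    by (intro has_integral_add has_integral_mult_right integrable_integral i1 i2)
  moreover have "(\<lambda>t. (2 * pi * n * r)^2 * ((l - t) * cos (2 * pi * n * t) / chord r n t) + (l - t) / chord r n t)
      = (\<lambda>t. (l - t) * neumann_kernel r n t)"
    unfolding neumann_kernel_def by (auto simp: fun_eq_iff add_divide_distrib algebra_simps)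
  ultimately have "integral {h..l} (\<lambda>t. (l - t) * neumann_kernel r n t)
     = (2 * pi * n * r)^2 * oscillatory_part r l n + integral {h..l} (\<lambda>t. (l - t) / chord r n t)"
    by (simp add: integral_unique)
  moreover have "integral {0..h} (neumann_remainder r l n) + integral {h..l} (neumann_remainder r l n)
      = integral {0..l} (neumann_remainder r l n)"
    using h assms by (intro Henstock_Kurzweil_Integration.integral_combine neumann_remainder_integrable) auto
  moreover have "ln (c * h) = ln c + ln h" using c h by (intro ln_mult_pos)
  ultimately show ?thesis
    unfolding neumann_energy_def using h
    by (simp add: integral_neumann_remainder helix_len_eq c_def[symmetric] algebra_simps)
qed

text \<open>The discarded terms are the integral over the first half turn, of order
  \<open>n\<close>; the integral of \<open>(l - t) / D\<close>, of order \<open>ln n\<close>; and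
  \<open>l * c * ln (c * h)\<close>, of order \<open>n\<close> because \<open>c * h\<close> tends to
  \<open>pi * r\<close>. All vanish after division by \<open>n^2\<close>.\<close>

lemma neumann_energy_asymptotics:
  assumes "r > 0" "l > 0"
  shows "((\<lambda>n. neumann_energy r l n / n^2 - (2 * pi * r)^2 * oscillatory_part r l n) \<longlongrightarrow> 0) at_top"
proof -
  let ?I = "\<lambda>n. integral {0..1 / (2 * n)} (neumann_remainder r l n)"
  let ?U = "\<lambda>n. integral {1 / (2 * n)..l} (\<lambda>t. (l - t) / chord r n t)"
  let ?M = "\<lambda>n. ((2 * pi * n * r)^2 + 1) / (4 * r * n)
    + l / (4 * r * n) * (2 * (2 * pi * n * r)^2 * (pi * n)^2 + 4 * r^2 * (pi * n)^4) * (1 / (2 * n))"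
  have ev: "\<forall>\<^sub>F n in at_top. n > 0 \<and> n > 1 / (2 * l)"
    by (intro eventually_conj eventually_gt_at_top)
  have I: "((\<lambda>n. ?I n / n^2) \<longlongrightarrow> 0) at_top"
  proof (rule Lim_null_comparison)
    show "\<forall>\<^sub>F n in at_top. norm (?I n / n^2) \<le> ?M n * (1 / (2 * n)) / n^2"
      using ev
    proof eventually_elim
      case (elim n)
      define h where "h = 1 / (2 * n)"
      have h: "0 < h" "h \<le> l" using elim assms unfolding h_def by (auto simp: field_simps)
      define C where "C = l / (4 * r * n) * (2 * (2 * pi * n * r)^2 * (pi * n)^2 + 4 * r^2 * (pi * n)^4)"
      have C: "C \<ge> 0" unfolding C_def using elim assms by simp
      have "norm (?I n) \<le> integral {0..h} (\<lambda>_. ?M n)"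
        unfolding h_def[symmetric]
      proof (rule Henstock_Kurzweil_Integration.integral_norm_bound_integral)
        show "neumann_remainder r l n integrable_on {0..h}"
          by (rule integrable_on_subinterval[OF neumann_remainder_integrable[OF assms(2)]]) (use h in auto)
        fix t assume t: "t \<in> {0..h}"
        show "norm (neumann_remainder r l n t) \<le> ((2 * pi * n * r)^2 + 1) / (4 * r * n)
          + l / (4 * r * n) * (2 * (2 * pi * n * r)^2 * (pi * n)^2 + 4 * r^2 * (pi * n)^4) * h"
        proof (cases "t = 0")
          case True
          then show ?thesis using C h elim assms unfolding C_def[symmetric]
            by (simp add: neumann_remainder_def neumann_kernel_def)
        next
          case False
          have "\<bar>neumann_remainder r l n t\<bar> \<le> ((2 * pi * n * r)^2 + 1) / (4 * r * n) + C * t"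
            unfolding C_def helix_speed_sq[symmetric]
            using False t h elim assms
            by (intro neumann_remainder_bound chord_ge_near_zero) (auto simp: h_def)
          moreover have "C * t \<le> C * h" using C t by (intro mult_left_mono) auto
          ultimately show ?thesis unfolding C_def[symmetric] by simp
        qed
      qed (rule integrable_const_ivl)
      also have "\<dots> = ?M n * h" using h by simp
      finally have "norm (?I n) / n^2 \<le> ?M n * h / n^2" by (rule divide_right_mono) simp
      then show ?case unfolding h_def norm_divide by simp
    qed
    show "((\<lambda>n. ?M n * (1 / (2 * n)) / n^2) \<longlongrightarrow> 0) at_top"
      using assms by real_asymp
  qed
  have U: "((\<lambda>n. ?U n / n^2) \<longlongrightarrow> 0) at_top"
  proof (rule Lim_null_comparison)
    show "\<forall>\<^sub>F n in at_top. norm (?U n / n^2) \<le> l * (ln l - ln (1 / (2 * n))) / n^2"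
      using ev
    proof eventually_elim
      case (elim n)
      define h where "h = 1 / (2 * n)"
      have h: "0 < h" "h \<le> l" using elim assms unfolding h_def by (auto simp: field_simps)
      have ne: "\<forall>t\<in>{h..l}. chord r n t \<noteq> 0" using h by auto
      have "norm (?U n) \<le> integral {h..l} (\<lambda>t. l / t)"
        unfolding h_def[symmetric]
      proof (rule Henstock_Kurzweil_Integration.integral_norm_bound_integral)
        show "(\<lambda>t. (l - t) / chord r n t) integrable_on {h..l}"
          by (intro integrable_continuous_real continuous_intros ne)
        show "(\<lambda>t. l / t) integrable_on {h..l}"
          using has_integral_inverse[OF h] by blast
        fix t assume "t \<in> {h..l}"
        then show "norm ((l - t) / chord r n t) \<le> l / t"
          using h abs_le_chord[of t r n] unfolding norm_divide by (intro frac_le) auto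
      qed
      also have "\<dots> = l * (ln l - ln h)" using has_integral_inverse[OF h] by (rule integral_unique)
      finally have "norm (?U n) / n^2 \<le> l * (ln l - ln h) / n^2" by (rule divide_right_mono) simp
      then show ?case unfolding h_def norm_divide by simp
    qed
    show "((\<lambda>n. l * (ln l - ln (1 / (2 * n))) / n^2) \<longlongrightarrow> 0) at_top"
      using assms by real_asymp
  qed
  have V: "((\<lambda>n. l * (helix_speed r n / n) * ln (helix_speed r n / n / 2) * (1 / n)) \<longlongrightarrow> 0) at_top"
  proof -
    have "((\<lambda>n. helix_speed r n / n) \<longlongrightarrow> 2 * pi * r) at_top"
      unfolding helix_speed_def using assms by real_asymp
    moreover have "((\<lambda>n::real. 1 / n) \<longlongrightarrow> 0) at_top" by real_asymp
    ultimately have "((\<lambda>n. l * (helix_speed r n / n) * ln (helix_speed r n / n / 2) * (1 / n))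
       \<longlongrightarrow> l * (2 * pi * r) * ln (2 * pi * r / 2) * 0) at_top"
      using assms by (intro tendsto_intros) auto
    then show ?thesis by simp
  qed
  have "((\<lambda>n. ?I n / n^2 + ?U n / n^2 + l * (helix_speed r n / n) * ln (helix_speed r n / n / 2) * (1 / n)) \<longlongrightarrow> 0 + 0 + 0) at_top"
    by (intro tendsto_add I U V)
  then have "((\<lambda>n. ?I n / n^2 + ?U n / n^2 + l * (helix_speed r n / n) * ln (helix_speed r n / n / 2) * (1 / n)) \<longlongrightarrow> 0) at_top"
    by simp
  then show ?thesis
  proof (rule Lim_transform_eventually)
    show "\<forall>\<^sub>F n in at_top. ?I n / n^2 + ?U n / n^2 + l * (helix_speed r n / n) * ln (helix_speed r n / n / 2) * (1 / n)
       = neumann_energy r l n / n^2 - (2 * pi * r)^2 * oscillatory_part r l n"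
      using ev
    proof eventually_elim
      case (elim n)
      have "neumann_energy r l n / n^2 = ((2 * pi * n * r)^2 * oscillatory_part r l n) / n^2
        + ?I n / n^2 + ?U n / n^2 + (l * helix_speed r n * ln (helix_speed r n * (1 / (2 * n)))) / n^2"
        using elim assms by (simp only: neumann_energy_split add_divide_distrib)
      moreover have "((2 * pi * n * r)^2 * oscillatory_part r l n) / n^2 = (2 * pi * r)^2 * oscillatory_part r l n"
        using elim by (simp add: power_mult_distrib)
      moreover have "(l * helix_speed r n * ln (helix_speed r n * (1 / (2 * n)))) / n^2
        = l * (helix_speed r n / n) * ln (helix_speed r n / n / 2) * (1 / n)"
        using elim by (simp add: power2_eq_square mult.commute)
      ultimately show ?case by linarith
    qed
  qed
qed

subsection \<open>The current sheet\<close>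

text \<open>Closed form of the integral of \<open>(l - t) / sqrt (b^2 + t^2)\<close> over
  \<open>{0..l}\<close>, which is half the Neumann double integral of two facing parallel segments
  of length \<open>l\<close> at distance \<open>b\<close>.\<close>

definition sheet_potential :: "real \<Rightarrow> real \<Rightarrow> real" where
  "sheet_potential l b = l * ln ((l + sqrt (l^2 + b^2)) / b) - sqrt (l^2 + b^2) + b"

lemma has_integral_sheet_potential:
  assumes "l > 0" "b > 0"
  shows "((\<lambda>t. (l - t) / sqrt (b^2 + t^2)) has_integral sheet_potential l b) {0..l}"
proof -
  let ?F = "\<lambda>t. l * ln (t + sqrt (b^2 + t^2)) - sqrt (b^2 + t^2)"
  have "((\<lambda>t. (l - t) / sqrt (b^2 + t^2)) has_integral (?F l - ?F 0)) {0..l}"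
  proof (rule fundamental_theorem_of_calculus)
    fix t assume "t \<in> {0..l}"
    then have t: "t \<ge> 0" by simp
    define R where "R = sqrt (b^2 + t^2)"
    have pos: "b^2 + t^2 > 0" using assms by (simp add: add_pos_nonneg)
    then have R: "R > 0" unfolding R_def by simp
    have dR: "((\<lambda>t. sqrt (b^2 + t^2)) has_real_derivative t / R) (at t)"
      unfolding R_def using pos by (auto intro!: derivative_eq_intros simp: field_simps)
    have "t + sqrt (b^2 + t^2) > 0" using R t unfolding R_def by linarith
    from DERIV_chain2[OF DERIV_ln_divide[OF this] DERIV_add[OF DERIV_ident dR]]
    have "((\<lambda>t. ln (t + sqrt (b^2 + t^2))) has_real_derivative (1 / (t + R)) * (1 + t / R)) (at t)"
      unfolding R_def .
    moreover have "(1 / (t + R)) * (1 + t / R) = 1 / R"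
    proof -
      have "1 + t / R = (t + R) / R" using R by (simp add: field_simps)
      moreover have "t + R \<noteq> 0" using R t by simp
      ultimately show ?thesis by simp
    qed
    ultimately have "((\<lambda>t. ln (t + sqrt (b^2 + t^2))) has_real_derivative 1 / R) (at t)" by simp
    from DERIV_diff[OF DERIV_cmult[OF this, of l] dR]
    have "(?F has_real_derivative (l - t) / sqrt (b^2 + t^2)) (at t)"
      unfolding R_def by (simp add: diff_divide_distrib)
    then show "(?F has_vector_derivative (l - t) / sqrt (b^2 + t^2)) (at t within {0..l})"
      by (simp add: has_real_derivative_iff_has_vector_derivative has_vector_derivative_at_within)
  qed (use assms in simp)
  moreover have "?F l - ?F 0 = sheet_potential l b"
  proof -
    have "ln ((l + sqrt (l^2 + b^2)) / b) = ln (l + sqrt (l^2 + b^2)) - ln b"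
      using assms by (intro ln_divide_pos) (auto intro!: add_pos_nonneg)
    then have "sheet_potential l b = l * ln (l + sqrt (l^2 + b^2)) - l * ln b - sqrt (l^2 + b^2) + b"
      unfolding sheet_potential_def by (simp only: right_diff_distrib)
    then show ?thesis using assms by (simp add: add.commute[of "b^2"])
  qed
  ultimately show ?thesis by simp
qed

text \<open>The logarithm contributes \<open>- l^2 / (R * b)\<close> and the root
  \<open>- b / R\<close>; since \<open>R^2 = l^2 + b^2\<close> they add up to
  \<open>- R / b\<close>.\<close>

lemma has_real_derivative_sheet_potential:
  assumes "l > 0" "b > 0"
  shows "(sheet_potential l has_real_derivative (1 - sqrt (l^2 + b^2) / b)) (at b)"
proof -
  define R where "R = sqrt (l^2 + b^2)"
  have pos: "l^2 + b^2 > 0" using assms by (simp add: add_pos_nonneg)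
  then have R: "R > 0" unfolding R_def by simp
  have R2: "R * R = l^2 + b^2" unfolding R_def using pos by simp
  have dR: "((\<lambda>b. sqrt (l^2 + b^2)) has_real_derivative b / R) (at b)"
    unfolding R_def using pos by (auto intro!: derivative_eq_intros simp: field_simps)
  have q: "(l + R) / b > 0" using assms R by simp
  have "((\<lambda>b. (l + sqrt (l^2 + b^2)) / b) has_real_derivative ((b / R) * b - (l + R)) / (b * b)) (at b)"
    using DERIV_divide[OF DERIV_add[OF DERIV_const dR] DERIV_ident] assms unfolding R_def by simp
  then have "((\<lambda>b. ln ((l + sqrt (l^2 + b^2)) / b)) has_real_derivative
      (1 / ((l + R) / b)) * (((b / R) * b - (l + R)) / (b * b))) (at b)"
    using q unfolding R_def by (intro DERIV_chain2[OF DERIV_ln_divide])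
  then have "(sheet_potential l has_real_derivative
      (l * ((1 / ((l + R) / b)) * (((b / R) * b - (l + R)) / (b * b))) - b / R + 1)) (at b)"
    unfolding sheet_potential_def[abs_def] by (intro DERIV_add DERIV_diff DERIV_cmult DERIV_ident dR)
  moreover have "l * ((1 / ((l + R) / b)) * (((b / R) * b - (l + R)) / (b * b))) - b / R + 1 = 1 - R / b"
  proof -
    have "(b / R) * b - (l + R) = - l * (l + R) / R"
      using R R2 by (simp add: field_simps power2_eq_square)
    moreover have "l + R > 0" using R assms by simp
    ultimately have "l * ((1 / ((l + R) / b)) * (((b / R) * b - (l + R)) / (b * b))) = - (l^2 / (R * b))"
      using assms R by (simp add: divide_simps power2_eq_square)
    moreover have "- (l^2 / (R * b)) - b / R = - (R * R / (R * b))"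
      unfolding R2 using assms R by (simp add: field_simps power2_eq_square)
    ultimately show ?thesis using R by simp
  qed
  ultimately show ?thesis unfolding R_def by simp
qed

definition sheet_integral :: "real \<Rightarrow> real \<Rightarrow> real" where
  "sheet_integral r l = - 2 * r / 3 + integral {0..pi/2} (\<lambda>y. (cos y)^2 * sqrt (l^2 + (2 * r * sin y)^2))"

lemma has_integral_sin_cos_sq: "((\<lambda>y. sin y * (cos y)^2) has_integral 1/3) {0..pi/2}"
proof -
  have "((\<lambda>y. sin y * (cos y)^2) has_integral (- ((cos (pi/2))^3 / 3) - - ((cos 0)^3 / 3))) {0..pi/2}"
  proof (rule fundamental_theorem_of_calculus)
    fix y :: real
    have "((\<lambda>y. - ((cos y)^3 / 3)) has_real_derivative sin y * (cos y)^2) (at y)"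
      by (auto intro!: derivative_eq_intros)
    then show "((\<lambda>y. - ((cos y)^3 / 3)) has_vector_derivative sin y * (cos y)^2) (at y within {0..pi/2})"
      by (simp add: has_real_derivative_iff_has_vector_derivative has_vector_derivative_at_within)
  qed simp
  then show ?thesis by simp
qed

text \<open>Integration by parts with \<open>sin (2 * y) / 2\<close> as antiderivative of the
  cosine. The boundary terms vanish, because the sine beats the logarithmic singularity at 0, and
  its factor \<open>sin y\<close> cancels the pole of the derivative of the potential.\<close>

lemma has_integral_cos_sheet_potential:
  assumes "r > 0" "l > 0"
  shows "((\<lambda>y. cos (2 * y) * sheet_potential l (2 * r * sin y)) has_integral sheet_integral r l) {0..pi/2}"
proof -
  let ?S = "\<lambda>y. sheet_potential l (2 * r * sin y)"
  let ?R = "\<lambda>y. sqrt (l^2 + (2 * r * sin y)^2)"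
  let ?F = "\<lambda>y. sin (2 * y) / 2 * ?S y"
  let ?f = "\<lambda>y. cos (2 * y) * ?S y + 2 * r * (sin y * (cos y)^2) - (cos y)^2 * ?R y"
  have pos: "sin y > 0" if "0 < y" "y \<le> pi/2" for y
    using that pi_gt_zero by (intro sin_gt_zero) linarith+
  have der: "(?F has_real_derivative ?f y) (at y)" if "0 < y" "y \<le> pi/2" for y
  proof -
    have b: "2 * r * sin y > 0" using pos[OF that] assms by simp
    have "((\<lambda>y. 2 * r * sin y) has_real_derivative 2 * r * cos y) (at y)"
      by (auto intro!: derivative_eq_intros)
    from DERIV_chain2[OF has_real_derivative_sheet_potential[OF assms(2) b] this]
    have dS: "(?S has_real_derivative (1 - ?R y / (2 * r * sin y)) * (2 * r * cos y)) (at y)" .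
    have "((\<lambda>y. sin (2 * y) / 2) has_real_derivative cos (2 * y)) (at y)"
      by (auto intro!: derivative_eq_intros)
    from DERIV_mult[OF this dS]
    have d: "(?F has_real_derivative (cos (2 * y) * ?S y + (1 - ?R y / (2 * r * sin y)) * (2 * r * cos y) * (sin (2 * y) / 2))) (at y)" .
    have e: "(1 - ?R y / (2 * r * sin y)) * (2 * r * cos y) * (sin (2 * y) / 2)
        = 2 * r * (sin y * (cos y)^2) - (cos y)^2 * ?R y"
      unfolding sin_double using pos[OF that] assms by (simp add: field_simps power2_eq_square)
    show ?thesis using d unfolding e by (simp only: add_diff_eq)
  qed
  have "(?f has_integral (?F (pi/2) - ?F 0)) {0..pi/2}"
  proof (rule fundamental_theorem_of_calculus_interior)
    show "continuous_on {0..pi/2} ?F"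
      unfolding continuous_on_eq_continuous_within
    proof
      fix y :: real assume y: "y \<in> {0..pi/2}"
      show "continuous (at y within {0..pi/2}) ?F"
      proof (cases "y = 0")
        case False
        then show ?thesis
          using der[of y] y by (auto intro: DERIV_isCont continuous_at_imp_continuous_at_within)
      next
        case True
        have "(?F \<longlongrightarrow> 0) (at_right 0)"
          unfolding sheet_potential_def using assms by real_asymp
        \<comment> \<open>The default value of the potential at distance 0 is multiplied by
          \<open>sin 0\<close>, so \<open>?F 0 = 0\<close> agrees with the limit.\<close>
        then show ?thesis unfolding True by (simp add: continuous_within at_within_Icc_at_right)
      qed
    qed
    show "(?F has_vector_derivative ?f y) (at y)" if "y \<in> {0<..<pi/2}" for y
      using der[of y] that by (simp add: has_real_derivative_iff_has_vector_derivative)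
  qed simp
  then have "(?f has_integral 0) {0..pi/2}" by simp
  moreover have "((\<lambda>y. 2 * r * (sin y * (cos y)^2) - (cos y)^2 * ?R y) has_integral
      (2 * r * (1/3) - integral {0..pi/2} (\<lambda>y. (cos y)^2 * ?R y))) {0..pi/2}"
    by (intro has_integral_diff has_integral_mult_right has_integral_sin_cos_sq
        integrable_integral integrable_continuous_real continuous_intros)
  ultimately have "((\<lambda>y. ?f y - (2 * r * (sin y * (cos y)^2) - (cos y)^2 * ?R y)) has_integral
      (0 - (2 * r * (1/3) - integral {0..pi/2} (\<lambda>y. (cos y)^2 * ?R y)))) {0..pi/2}"
    by (rule has_integral_diff)
  then show ?thesis unfolding sheet_integral_def by (simp add: algebra_simps)
qed

lemma L_rl_sheet_integral:
  assumes "l > 0"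
  shows "L_rl \<mu>0 r l = 4 * \<mu>0 * r^2 * sheet_integral r l"
  unfolding sheet_integral_def by (rule L_rl_eq[OF assms])

text \<open>On each cell the integral lies between \<open>h\<close> times the values at the right
  and the left end; the differences telescope.\<close>

lemma antimono_riemann_sum:
  fixes f :: "real \<Rightarrow> real"
  assumes cont: "continuous_on {0..} f" and anti: "\<And>x y. 0 \<le> x \<Longrightarrow> x \<le> y \<Longrightarrow> f y \<le> f x"
    and "s \<ge> 0" "h \<ge> 0"
  shows "integral {s..s + real N * h} f \<le> h * (\<Sum>k<N. f (s + real k * h))
    \<and> h * (\<Sum>k<N. f (s + real k * h)) \<le> integral {s..s + real N * h} f + h * f s - h * f (s + real N * h)"
proof (induction N)
  case (Suc N)
  let ?a = "s + real N * h"
  let ?b = "s + real (Suc N) * h"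
  have ab: "0 \<le> ?a" "s \<le> ?a" "?a \<le> ?b" "?b - ?a = h" using assms by (auto simp: algebra_simps)
  have int: "f integrable_on {x..y}" if "0 \<le> x" for x y
    by (rule integrable_continuous_real, rule continuous_on_subset[OF cont]) (use that in auto)
  have comb: "integral {s..?a} f + integral {?a..?b} f = integral {s..?b} f"
    by (rule Henstock_Kurzweil_Integration.integral_combine) (use ab assms int in auto)
  have "integral {?a..?b} f \<le> integral {?a..?b} (\<lambda>_. f ?a)"
    by (rule integral_le) (use ab int anti in auto)
  then have up: "integral {?a..?b} f \<le> h * f ?a" using ab by simp
  have "integral {?a..?b} (\<lambda>_. f ?b) \<le> integral {?a..?b} f"
    by (rule integral_le) (use ab int anti in auto)
  then have lo: "h * f ?b \<le> integral {?a..?b} f" using ab by simp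
  have "h * (\<Sum>k<Suc N. f (s + real k * h)) = h * (\<Sum>k<N. f (s + real k * h)) + h * f ?a"
    by (simp add: algebra_simps)
  with Suc comb up lo show ?case by linarith
qed simp

text \<open>The sum differs from the integral of \<open>p\<close> over \<open>{0..s}\<close> plus
  the rest by at most \<open>h * p s\<close>, and that initial integral is small as well. Both are
  estimated by \<open>p t \<le> l / sqrt (b * t)\<close>, whose dependence \<open>1 / sqrt b\<close>
  is still integrable over the phase. Cutting \<open>p\<close> off at \<open>l\<close> lets the sum
  run past \<open>l\<close>.\<close>

lemma riemann_sum_sheet:
  assumes "b > 0" "l > 0" "0 < h" "h / 2 \<le> s" "s \<le> 2 * h" "l \<le> s + real N * h"
  defines "p \<equiv> \<lambda>t. max 0 (l - t) / sqrt (b^2 + t^2)"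
  shows "\<bar>h * (\<Sum>k<N. p (s + real k * h)) - sheet_potential l b\<bar> \<le> 6 * l * sqrt h / sqrt b"
proof -
  have s: "s > 0" using assms by linarith
  have pos: "b^2 + t^2 > 0" for t using assms by (simp add: add_pos_nonneg)
  have p0: "p t \<ge> 0" for t unfolding p_def by simp
  have cont: "continuous_on {0..} p"
    unfolding p_def using less_imp_neq[OF pos, symmetric] by (intro continuous_intros) simp
  have anti: "p y \<le> p x" if "0 \<le> x" "x \<le> y" for x y
    unfolding p_def
  proof (rule frac_le)
    show "sqrt (b^2 + x^2) \<le> sqrt (b^2 + y^2)" using power_mono[OF that(2,1), of 2] by simp
    show "0 < sqrt (b^2 + x^2)" using pos[of x] by simp
  qed (use that in auto)
  have int: "p integrable_on {x..y}" if "0 \<le> x" for x y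
    by (rule integrable_continuous_real, rule continuous_on_subset[OF cont]) (use that in auto)
  have bound: "p t \<le> l / sqrt (b * t)" if "t > 0" for t
  proof -
    \<comment> \<open>The arithmetic-geometric mean inequality distributes the decay evenly between
      \<open>b\<close> and \<open>t\<close>.\<close>
    have "b * t \<le> b^2 + t^2"
      using sum_squares_bound[of b t] mult_pos_pos[OF assms(1) that] by linarith
    then show ?thesis unfolding p_def using that assms by (intro frac_le) auto
  qed
  have split: "integral {0..s} p + integral {s..s + real N * h} p = sheet_potential l b"
  proof -
    have L: "(p has_integral sheet_potential l b) {0..l}"
      using has_integral_sheet_potential[OF assms(2,1)]
      by (rule has_integral_eq[rotated]) (simp add: p_def)
    have "(p has_integral 0) {l..s + real N * h}"
      by (rule has_integral_is_0) (simp add: p_def)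
    from has_integral_combine[OF _ _ L this]
    have "(p has_integral sheet_potential l b) {0..s + real N * h}" using assms by simp
    moreover have "integral {0..s} p + integral {s..s + real N * h} p = integral {0..s + real N * h} p"
      by (rule Henstock_Kurzweil_Integration.integral_combine) (use s assms int in auto)
    ultimately show ?thesis by (simp add: integral_unique)
  qed
  have sq: "((\<lambda>t. l / sqrt (b * t)) has_integral (2 * l / sqrt b * sqrt s)) {0..s}"
  proof -
    have "((\<lambda>t. l / sqrt (b * t)) has_integral (2 * l / sqrt b * sqrt s - 2 * l / sqrt b * sqrt 0)) {0..s}"
    proof (rule fundamental_theorem_of_calculus_interior)
      show "continuous_on {0..s} (\<lambda>t. 2 * l / sqrt b * sqrt t)"
        using assms by (intro continuous_intros) auto
      fix t assume "t \<in> {0<..<s}"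
      then have "((\<lambda>t. 2 * l / sqrt b * sqrt t) has_real_derivative l / sqrt (b * t)) (at t)"
        using assms by (auto intro!: derivative_eq_intros simp: real_sqrt_mult field_simps)
      then show "((\<lambda>t. 2 * l / sqrt b * sqrt t) has_vector_derivative l / sqrt (b * t)) (at t)"
        by (simp add: has_real_derivative_iff_has_vector_derivative)
    qed (use s in simp)
    then show ?thesis by simp
  qed
  have i0: "integral {0..s} p \<le> 2 * l / sqrt b * sqrt s"
  proof -
    \<comment> \<open>The majorant is 0 at \<open>t = 0\<close> by the convention for division, so
      \<open>p\<close> is changed to 0 there as well.\<close>
    have "((\<lambda>t. if t = 0 then 0 else p t) has_integral integral {0..s} p) {0..s}"
      by (rule has_integral_spike_finite[where S = "{0}", OF _ _ integrable_integral[OF int]]) auto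
    then show ?thesis by (rule has_integral_le[OF _ sq]) (use bound assms in auto)
  qed
  have i0': "0 \<le> integral {0..s} p" by (rule integral_nonneg) (use int p0 in auto)
  have i1: "h * p s \<le> 2 * l / sqrt b * sqrt s"
  proof -
    have "h * p s \<le> 2 * s * (l / sqrt (b * s))"
      using assms(3,4) s p0 bound[OF s] by (intro mult_mono) auto
    also have "\<dots> = 2 * l / sqrt b * (s / sqrt s)" by (simp add: real_sqrt_mult)
    also have "s / sqrt s = sqrt s" using s by (simp add: real_div_sqrt)
    finally show ?thesis .
  qed
  \<comment> \<open>The bound \<open>s \<le> 2 * h\<close> is enlarged to \<open>9/4 * h\<close>,
    whose factor has a rational root.\<close>
  have "sqrt s \<le> sqrt (9/4 * h)" using assms by simp
  also have "\<dots> = 3/2 * sqrt h" by (simp add: real_sqrt_mult real_sqrt_divide)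
  finally have "2 * l / sqrt b * sqrt s \<le> 2 * l / sqrt b * (3/2 * sqrt h)"
    using assms by (intro mult_left_mono) auto
  moreover define X where "X = l * sqrt h / sqrt b"
  ultimately have i2: "2 * l / sqrt b * sqrt s \<le> 3 * X" by simp
  have "integral {s..s + real N * h} p \<le> h * (\<Sum>k<N. p (s + real k * h))"
    "h * (\<Sum>k<N. p (s + real k * h)) \<le> integral {s..s + real N * h} p + h * p s - h * p (s + real N * h)"
    using antimono_riemann_sum[OF cont anti, of s h N] s assms by auto
  moreover have "0 \<le> h * p (s + real N * h)" using p0 assms by simp
  moreover have "0 \<le> X" unfolding X_def using assms by simp
  moreover have "integral {0..s} p \<le> 3 * X" "h * p s \<le> 3 * X" by (rule order_trans[OF i0 i2], rule order_trans[OF i1 i2])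
  ultimately have "\<bar>h * (\<Sum>k<N. p (s + real k * h)) - sheet_potential l b\<bar> \<le> 6 * X"
    using split i0' by (intro abs_leI; linarith)
  then show ?thesis unfolding X_def by simp
qed

subsection \<open>Averaging over a turn\<close>

lemma integral_affine:
  fixes f :: "real \<Rightarrow> real"
  assumes "f integrable_on {c * a + d..c * b + d}" "c > 0"
  shows "integral {c * a + d..c * b + d} f = c * integral {a..b} (\<lambda>x. f (c * x + d))"
proof -
  have img: "(\<lambda>x. (1 / c) *\<^sub>R x + - ((1 / c) *\<^sub>R d)) ` cbox (c * a + d) (c * b + d) = {a..b}"
    using assms(2) unfolding cbox_interval real_scaleR_def
    by (subst image_affinity_atLeastAtMost) (auto simp: field_simps)
  have "((\<lambda>x. f (c *\<^sub>R x + d)) has_integral ((1 / \<bar>c\<bar> ^ DIM(real)) *\<^sub>R integral {c * a + d..c * b + d} f))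
     ((\<lambda>x. (1 / c) *\<^sub>R x + - ((1 / c) *\<^sub>R d)) ` cbox (c * a + d) (c * b + d))"
    using integrable_integral[OF assms(1)] assms(2) unfolding cbox_interval[symmetric]
    by (intro has_integral_affinity) auto
  from integral_unique[OF this[unfolded img]] show ?thesis
    using assms(2) by (simp add: field_simps)
qed

lemma integral_sum_consecutive:
  fixes f :: "real \<Rightarrow> real"
  assumes "h \<ge> 0" "\<And>x y. a \<le> x \<Longrightarrow> f integrable_on {x..y}"
  shows "integral {a..a + real N * h} f = (\<Sum>k<N. integral {a + real k * h..a + (real k + 1) * h} f)"
proof (induction N)
  case (Suc N)
  have "integral {a..a + real N * h} f + integral {a + real N * h..a + real (Suc N) * h} f
      = integral {a..a + real (Suc N) * h} f"
    by (rule Henstock_Kurzweil_Integration.integral_combine) (use assms in \<open>auto simp: algebra_simps\<close>)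
  with Suc show ?case by (simp add: add.commute)
qed simp

lemma has_integral_even:
  fixes f :: "real \<Rightarrow> real"
  assumes "(f has_integral I) {0..a}" "\<And>x. f (- x) = f x" "a \<ge> 0"
  shows "(f has_integral 2 * I) {-a..a}"
proof -
  have "((\<lambda>x. f (- x)) has_integral I) {-a..-0}"
    using assms(1) by (subst has_integral_reflect_real)
  then have "(f has_integral I) {-a..0}" using assms(2) by simp
  from has_integral_combine[OF _ _ this assms(1)] show ?thesis using assms(3) by simp
qed

lemma cos_shift_multiple: "cos (x + 2 * pi * real k) = cos x"
  using cos.plus_of_nat[of x k] by (simp add: mult_ac)

text \<open>In the cell number \<open>k\<close> the substitution
  \<open>t = (k + 1) * h + y * h / pi\<close> fixes the phase: cosine and sine terms depend only on
  \<open>y\<close>. Thus the cosine leaves the sum over \<open>k\<close>, and a Riemann sum with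
  step \<open>h\<close> remains.\<close>

lemma oscillatory_part_eq:
  fixes n :: real
  assumes "n > 0"
  defines "h \<equiv> 1 / n"
  assumes "h / 2 \<le> l" "l \<le> h / 2 + real N * h"
  shows "((\<lambda>y. cos (2 * y) * (h * (\<Sum>k<N. max 0 (l - (h + y * h / pi + real k * h))
        / sqrt ((2 * r * sin y)^2 + (h + y * h / pi + real k * h)^2))))
      has_integral pi * oscillatory_part r l n) {-(pi/2)..pi/2}"
proof -
  have h: "h > 0" "n * h = 1" unfolding h_def using assms(1) by auto
  \<comment> \<open>Extending the weight by 0 beyond \<open>l\<close> allows a whole number of
    periods.\<close>
  define f where "f = (\<lambda>t. max 0 (l - t) * cos (2 * pi * n * t) / chord r n t)"
  define P where "P = (\<lambda>k y. max 0 (l - (h + y * h / pi + real k * h))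
        / sqrt ((2 * r * sin y)^2 + (h + y * h / pi + real k * h)^2))"
  have cont: "continuous_on {x..y} f" if "h / 2 \<le> x" for x y
    unfolding f_def using that h by (intro continuous_intros) auto
  have int: "f integrable_on {x..y}" if "h / 2 \<le> x" for x y
    by (rule integrable_continuous_real[OF cont[OF that]])
  have "oscillatory_part r l n = integral {h / 2..l} f"
  proof -
    have "1 / (2 * n) = h / 2" unfolding h_def by simp
    then show ?thesis
      unfolding oscillatory_part_def f_def
      by (simp only:, intro Henstock_Kurzweil_Integration.integral_cong) auto
  qed
  also have "\<dots> = integral {h / 2..l} f + integral {l..h / 2 + real N * h} f"
    using has_integral_is_0[of "{l..h / 2 + real N * h}" f] by (simp add: f_def integral_unique)
  also have "\<dots> = integral {h / 2..h / 2 + real N * h} f"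
    by (rule Henstock_Kurzweil_Integration.integral_combine) (use assms int in auto)
  also have "\<dots> = (\<Sum>k<N. integral {h / 2 + real k * h..h / 2 + (real k + 1) * h} f)"
    by (rule integral_sum_consecutive) (use h int in auto)
  also have "\<dots> = (\<Sum>k<N. integral {-(pi/2)..pi/2} (\<lambda>y. h / pi * (cos (2 * y) * P k y)))"
  proof (rule sum.cong[OF refl])
    fix k
    let ?d = "(real k + 1) * h"
    have ivl: "h / pi * - (pi/2) + ?d = h / 2 + real k * h" "h / pi * (pi/2) + ?d = h / 2 + (real k + 1) * h"
      by (auto simp: field_simps)
    have "integral {h / pi * - (pi/2) + ?d..h / pi * (pi/2) + ?d} f
       = h / pi * integral {-(pi/2)..pi/2} (\<lambda>y. f (h / pi * y + ?d))"
      by (rule integral_affine) (use h int ivl in auto)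
    also have "\<dots> = integral {-(pi/2)..pi/2} (\<lambda>y. h / pi * f (h / pi * y + ?d))" by simp
    also have "(\<lambda>y. f (h / pi * y + ?d)) = (\<lambda>y. cos (2 * y) * P k y)"
    proof
      fix y
      let ?t = "h / pi * y + ?d"
      have t: "?t = h + y * h / pi + real k * h" by (simp add: algebra_simps)
      have "2 * pi * n * ?t = 2 * (n * h) * y + 2 * pi * (n * h) * (real k + 1)"
        by (simp add: field_simps)
      then have "2 * pi * n * ?t = 2 * y + 2 * pi * real (Suc k)" unfolding h by simp
      then have c: "cos (2 * pi * n * ?t) = cos (2 * y)" by (simp only: cos_shift_multiple)
      \<comment> \<open>The sine itself is reproduced only up to sign; its square follows from the
        cosine of the double angle.\<close>
      have "cos (2 * (pi * n * ?t)) = cos (2 * y)" using c by (simp add: mult.assoc)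
      then have "(sin (pi * n * ?t))^2 = (sin y)^2" unfolding cos_double_sin by simp
      then have "chord r n ?t = sqrt ((2 * r * sin y)^2 + ?t^2)"
        unfolding chord_def by (simp add: power_mult_distrib)
      then show "f ?t = cos (2 * y) * P k y"
        unfolding f_def P_def t[symmetric] c by simp
    qed
    finally show "integral {h / 2 + real k * h..h / 2 + (real k + 1) * h} f
      = integral {-(pi/2)..pi/2} (\<lambda>y. h / pi * (cos (2 * y) * P k y))"
      unfolding ivl .
  qed
  finally have osc: "pi * oscillatory_part r l n = pi * (\<Sum>k<N. integral {-(pi/2)..pi/2} (\<lambda>y. h / pi * (cos (2 * y) * P k y)))"
    by simp
  have cP: "continuous_on {-(pi/2)..pi/2} (P k)" for k
  proof -
    \<comment> \<open>At phase 0 the sine term vanishes, but the height difference is at least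
      \<open>h / 2\<close> in every cell.\<close>
    have "(2 * r * sin y)^2 + (h + y * h / pi + real k * h)^2 > 0" if "y \<in> {-(pi/2)..pi/2}" for y
    proof -
      have "- (pi / 2) * h / pi \<le> y * h / pi" using that h by (intro divide_right_mono mult_right_mono) auto
      then have "- (h / 2) \<le> y * h / pi" by simp
      moreover have "0 \<le> real k * h" using h by simp
      ultimately have "h + y * h / pi + real k * h > 0" using h by linarith
      then show ?thesis by (simp add: add_nonneg_pos)
    qed
    then show ?thesis unfolding P_def by (intro continuous_intros) force+
  qed
  have "((\<lambda>y. pi * (\<Sum>k<N. h / pi * (cos (2 * y) * P k y))) has_integral pi * oscillatory_part r l n) {-(pi/2)..pi/2}"
    unfolding osc by (intro has_integral_mult_right has_integral_sum integrable_integral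
        integrable_continuous_real continuous_intros cP) auto
  moreover have "(\<lambda>y. pi * (\<Sum>k<N. h / pi * (cos (2 * y) * P k y))) = (\<lambda>y. cos (2 * y) * (h * (\<Sum>k<N. P k y)))"
    by (auto simp: sum_distrib_left mult_ac)
  ultimately show ?thesis unfolding P_def by simp
qed

text \<open>For each nonzero phase the Riemann sum approximates the sheet potential at distance
  \<open>2 * r * \<bar>sin y\<bar>\<close>. Jordan's inequality bounds the error by
  \<open>6 * l * sqrt h\<close> times the integrable function \<open>\<beta>\<close>, so the total
  error is of order \<open>n\<close> to the power \<open>-1/2\<close>.\<close>

lemma oscillatory_part_tendsto:
  assumes "r > 0" "l > 0"
  shows "(oscillatory_part r l \<longlongrightarrow> 2 / pi * sheet_integral r l) at_top"
proof -
  define \<beta> where "\<beta> = (\<lambda>y. 1 / sqrt (4 * r * \<bar>y\<bar> / pi))"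
  have "\<exists>B. (\<beta> has_integral B) {-(pi/2)..pi/2}"
  proof -
    define k where "k = 1 / sqrt (4 * r / pi)"
    have "((\<lambda>y. k / sqrt y) has_integral (2 * k * sqrt (pi/2) - 2 * k * sqrt 0)) {0..pi/2}"
    proof (rule fundamental_theorem_of_calculus_interior)
      show "continuous_on {0..pi/2} (\<lambda>y. 2 * k * sqrt y)" by (intro continuous_intros)
      fix y :: real assume "y \<in> {0<..<pi/2}"
      then have "((\<lambda>y. 2 * k * sqrt y) has_real_derivative k / sqrt y) (at y)"
        by (auto intro!: derivative_eq_intros simp: field_simps)
      then show "((\<lambda>y. 2 * k * sqrt y) has_vector_derivative k / sqrt y) (at y)"
        by (simp add: has_real_derivative_iff_has_vector_derivative)
    qed simp
    then have "(\<beta> has_integral (2 * k * sqrt (pi/2) - 2 * k * sqrt 0)) {0..pi/2}"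
    proof (rule has_integral_eq[rotated])
      fix y :: real assume "y \<in> {0..pi/2}"
      then have "4 * r * \<bar>y\<bar> / pi = (4 * r / pi) * y" by simp
      then show "k / sqrt y = \<beta> y" unfolding \<beta>_def k_def by (simp only: real_sqrt_mult) simp
    qed
    from has_integral_even[OF this] show ?thesis unfolding \<beta>_def by auto
  qed
  then obtain B where B: "(\<beta> has_integral B) {-(pi/2)..pi/2}" ..
  \<comment> \<open>The absolute value makes \<open>G\<close> even, so its integral over the whole
    turn is twice \<open>sheet_integral r l\<close>.\<close>
  define G where "G = (\<lambda>y. cos (2 * y) * sheet_potential l (2 * r * \<bar>sin y\<bar>))"
  have "(G has_integral sheet_integral r l) {0..pi/2}"
    using has_integral_cos_sheet_potential[OF assms]
  proof (rule has_integral_eq[rotated])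
    fix y :: real assume "y \<in> {0..pi/2}"
    then have "sin y \<ge> 0" using pi_ge_zero by (intro sin_ge_zero) auto
    then show "cos (2 * y) * sheet_potential l (2 * r * sin y) = G y" unfolding G_def by simp
  qed
  then have G: "(G has_integral 2 * sheet_integral r l) {-(pi/2)..pi/2}"
    by (rule has_integral_even) (auto simp: G_def)
  have bound: "\<bar>pi * oscillatory_part r l n - 2 * sheet_integral r l\<bar> \<le> 6 * l * sqrt (1 / n) * B"
    if n: "n > 0" "n > 1 / (2 * l)" for n
  proof -
    define h where "h = 1 / n"
    have h: "h > 0" "h / 2 \<le> l" using n assms unfolding h_def by (auto simp: field_simps)
    \<comment> \<open>Enough periods to reach past \<open>l\<close>.\<close>
    define N where "N = nat \<lceil>l * n\<rceil>"
    have "l * n \<le> real N" unfolding N_def by linarith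
    then have "l \<le> real N * h" using n unfolding h_def by (simp add: field_simps)
    then have N: "l \<le> h / 2 + real N * h" using h by linarith
    define S where "S = (\<lambda>y. h * (\<Sum>k<N. max 0 (l - (h + y * h / pi + real k * h))
        / sqrt ((2 * r * sin y)^2 + (h + y * h / pi + real k * h)^2)))"
    have osc: "((\<lambda>y. cos (2 * y) * S y) has_integral pi * oscillatory_part r l n) {-(pi/2)..pi/2}"
      unfolding S_def h_def
      by (rule oscillatory_part_eq) (use n h(2) N in \<open>simp_all add: h_def\<close>)
    \<comment> \<open>Phase 0 is removed: there the distance is 0, outside the scope of the Riemann
      estimate, and \<open>\<beta>\<close> has the default value 0.\<close>
    have "((\<lambda>y. if y = 0 then 0 else cos (2 * y) * S y - G y) has_integral
        (pi * oscillatory_part r l n - 2 * sheet_integral r l)) {-(pi/2)..pi/2}"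
      by (rule has_integral_spike_finite[where S = "{0}", OF _ _ has_integral_diff[OF osc G]]) auto
    moreover have "((\<lambda>y. 6 * l * sqrt h * \<beta> y) has_integral 6 * l * sqrt h * B) {-(pi/2)..pi/2}"
      by (rule has_integral_mult_right[OF B])
    moreover have "norm (if y = 0 then 0 else cos (2 * y) * S y - G y) \<le> 6 * l * sqrt h * \<beta> y"
      if y: "y \<in> {-(pi/2)..pi/2}" for y
    proof (cases "y = 0")
      case True
      then show ?thesis by (simp add: \<beta>_def)
    next
      case False
      have "(2 * y / pi)^2 \<le> (sin y)^2" using y by (intro jordan_sin_sq) auto
      then have "\<bar>2 * y / pi\<bar> \<le> \<bar>sin y\<bar>" unfolding abs_le_square_iff .
      then have "2 * r * \<bar>2 * y / pi\<bar> \<le> 2 * r * \<bar>sin y\<bar>" using assms by (intro mult_left_mono) auto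
      then have b: "4 * r * \<bar>y\<bar> / pi \<le> 2 * r * \<bar>sin y\<bar>" by (simp add: abs_mult)
      have y0: "4 * r * \<bar>y\<bar> / pi > 0" using False assms by simp
      have "- (pi / 2) * h / pi \<le> y * h / pi" "y * h / pi \<le> pi / 2 * h / pi"
        by (intro divide_right_mono mult_right_mono; use y h in simp)+
      moreover have "- (pi / 2) * h / pi = - (h / 2)" "pi / 2 * h / pi = h / 2" by auto
      ultimately have s: "h / 2 \<le> h + y * h / pi" "h + y * h / pi \<le> 2 * h" using h by linarith+
      have sN: "l \<le> h + y * h / pi + real N * h" using s N by linarith
      have "\<bar>S y - sheet_potential l (2 * r * \<bar>sin y\<bar>)\<bar> \<le> 6 * l * sqrt h / sqrt (2 * r * \<bar>sin y\<bar>)"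
        using riemann_sum_sheet[OF less_le_trans[OF y0 b] assms(2) h(1) s sN]
        unfolding S_def by (simp add: power_mult_distrib)
      also have "\<dots> \<le> 6 * l * sqrt h / sqrt (4 * r * \<bar>y\<bar> / pi)"
        using b y0 h assms by (intro divide_left_mono mult_pos_pos) auto
      also have "\<dots> = 6 * l * sqrt h * \<beta> y" unfolding \<beta>_def by simp
      finally have le: "\<bar>S y - sheet_potential l (2 * r * \<bar>sin y\<bar>)\<bar> \<le> 6 * l * sqrt h * \<beta> y" .
      have "\<bar>cos (2 * y) * S y - G y\<bar> = \<bar>cos (2 * y)\<bar> * \<bar>S y - sheet_potential l (2 * r * \<bar>sin y\<bar>)\<bar>"
        unfolding G_def by (simp flip: abs_mult right_diff_distrib)
      also have "\<dots> \<le> 1 * \<bar>S y - sheet_potential l (2 * r * \<bar>sin y\<bar>)\<bar>"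
        by (rule mult_right_mono) auto
      finally show ?thesis using le False by simp
    qed
    ultimately have "norm (pi * oscillatory_part r l n - 2 * sheet_integral r l) \<le> 6 * l * sqrt h * B"
      by (metis (no_types, lifting) has_integral_iff Henstock_Kurzweil_Integration.integral_norm_bound_integral)
    then show ?thesis unfolding h_def by simp
  qed
  have "((\<lambda>n. pi * oscillatory_part r l n - 2 * sheet_integral r l) \<longlongrightarrow> 0) at_top"
  proof (rule Lim_null_comparison)
    show "\<forall>\<^sub>F n in at_top. norm (pi * oscillatory_part r l n - 2 * sheet_integral r l) \<le> 6 * l * sqrt (1 / n) * B"
      using eventually_gt_at_top[of 0] eventually_gt_at_top[of "1 / (2 * l)"]
      by eventually_elim (use bound in simp)
    have "((\<lambda>n. sqrt (1 / n)) \<longlongrightarrow> 0) at_top" by real_asymp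
    then have "((\<lambda>n. 6 * l * sqrt (1 / n) * B) \<longlongrightarrow> 6 * l * 0 * B) at_top" by (intro tendsto_intros)
    then show "((\<lambda>n. 6 * l * sqrt (1 / n) * B) \<longlongrightarrow> 0) at_top" by simp
  qed
  then have "((\<lambda>n. 1 / pi * (pi * oscillatory_part r l n - 2 * sheet_integral r l) + 2 / pi * sheet_integral r l)
      \<longlongrightarrow> 1 / pi * 0 + 2 / pi * sheet_integral r l) at_top"
    by (intro tendsto_intros)
  moreover have "1 / pi * (pi * oscillatory_part r l n - 2 * sheet_integral r l) + 2 / pi * sheet_integral r l = oscillatory_part r l n" for n
    by (simp add: field_simps)
  ultimately show ?thesis by simp
qed

section \<open>Assembly of the limits of both inductances\<close>

lemma H_N_asymptotics:
  assumes "r > 0" "l > 0"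
  shows "((\<lambda>n. H_N \<mu> r l n / n^2) \<longlongrightarrow> L_rl \<mu> r l) at_top"
proof -
  have "((\<lambda>n. \<mu> / (2 * pi) * ((neumann_energy r l n / n^2 - (2 * pi * r)^2 * oscillatory_part r l n)
        + (2 * pi * r)^2 * oscillatory_part r l n))
      \<longlongrightarrow> \<mu> / (2 * pi) * (0 + (2 * pi * r)^2 * (2 / pi * sheet_integral r l))) at_top"
    by (intro tendsto_intros neumann_energy_asymptotics oscillatory_part_tendsto assms)
  \<comment> \<open>The constants multiply to \<open>4 * \<mu> * r^2\<close>, the prefactor in the
    integral form of \<open>L_rl\<close>.\<close>
  moreover have "\<mu> / (2 * pi) * (0 + (2 * pi * r)^2 * (2 / pi * sheet_integral r l)) = L_rl \<mu> r l"
    unfolding L_rl_sheet_integral[OF assms(2)] by (simp add: field_simps power2_eq_square)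
  moreover have "\<forall>\<^sub>F n in at_top. \<mu> / (2 * pi) * ((neumann_energy r l n / n^2 - (2 * pi * r)^2 * oscillatory_part r l n)
        + (2 * pi * r)^2 * oscillatory_part r l n) = H_N \<mu> r l n / n^2"
    using eventually_gt_at_top[of 0] by eventually_elim (simp add: H_N_eq assms)
  ultimately show ?thesis by (auto intro: Lim_transform_eventually)
qed

text \<open>The two inductances differ by a multiple of
  \<open>chord r n l - helix_len r l n\<close>, where the chord is bounded in \<open>n\<close> and
  the length grows linearly.\<close>

lemma H_W_asymptotics:
  assumes "r > 0" "l > 0"
  shows "((\<lambda>n. H_W \<mu> r l n / n^2) \<longlongrightarrow> L_rl \<mu> r l) at_top"
proof -
  have "((\<lambda>n. chord r n l / n^2) \<longlongrightarrow> 0) at_top"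
  proof (rule Lim_null_comparison)
    have "chord r n l \<le> sqrt (4 * r^2 + l^2)" for n
      unfolding chord_def by (simp add: mult_left_le abs_square_le_1)
    then show "\<forall>\<^sub>F n in at_top. norm (chord r n l / n^2) \<le> sqrt (4 * r^2 + l^2) / n^2"
      by (auto intro!: always_eventually divide_right_mono)
    show "((\<lambda>n. sqrt (4 * r^2 + l^2) / n^2) \<longlongrightarrow> 0) at_top" by real_asymp
  qed
  moreover have "((\<lambda>n. helix_len r l n / n^2) \<longlongrightarrow> 0) at_top"
    unfolding helix_len_def using assms by real_asymp
  ultimately have "((\<lambda>n. H_N \<mu> r l n / n^2 - \<mu> / (2 * pi) * (chord r n l / n^2 - helix_len r l n / n^2))
      \<longlongrightarrow> L_rl \<mu> r l - \<mu> / (2 * pi) * (0 - 0)) at_top"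
    by (intro tendsto_intros H_N_asymptotics assms)
  then have "((\<lambda>n. H_N \<mu> r l n / n^2 - \<mu> / (2 * pi) * (chord r n l / n^2 - helix_len r l n / n^2))
      \<longlongrightarrow> L_rl \<mu> r l) at_top" by simp
  then show ?thesis
  proof (rule Lim_transform_eventually)
    show "\<forall>\<^sub>F n in at_top. H_N \<mu> r l n / n^2 - \<mu> / (2 * pi) * (chord r n l / n^2 - helix_len r l n / n^2)
      = H_W \<mu> r l n / n^2"
      using eventually_gt_at_top[of 0]
      by eventually_elim (simp add: H_N_eq H_W_eq assms diff_divide_distrib right_diff_distrib)
  qed
qed

text \<open>Convergence of the regularized integrals is part of the claim, since \<open>Lim\<close>
  denotes the intended value only if the limit exists.\<close>

theorem theorem2p9:
  fixes \<mu>0 r l :: real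
  assumes "r > 0" and "l > 0" and "\<mu>0 > 0"
  shows "(\<forall>n>0. (neumann_reg \<mu>0 (helix_gamma r n) (helix_len r l n)
                      \<longlongrightarrow> H_N \<mu>0 r l n) (at_right 0)
              \<and> (weber_reg \<mu>0 (helix_gamma r n) (helix_len r l n)
                      \<longlongrightarrow> H_W \<mu>0 r l n) (at_right 0))
       \<and> ((\<lambda>n. H_N \<mu>0 r l n / n^2) \<longlongrightarrow> L_rl \<mu>0 r l) at_top
       \<and> ((\<lambda>n. H_W \<mu>0 r l n / n^2) \<longlongrightarrow> L_rl \<mu>0 r l) at_top
       \<and> ((\<lambda>l'. L_rl \<mu>0 r l' - \<mu>0 * (pi * r^2 * l' - 8/3 * r^3)) \<longlongrightarrow> 0) at_top"
proof (intro conjI allI impI)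
  fix n :: real assume "n > 0"
  then show "(neumann_reg \<mu>0 (helix_gamma r n) (helix_len r l n) \<longlongrightarrow> H_N \<mu>0 r l n) (at_right 0)"
    using neumann_reg_tendsto[of l n \<mu>0 r] assms by (simp add: H_N_eq)
  show "(weber_reg \<mu>0 (helix_gamma r n) (helix_len r l n) \<longlongrightarrow> H_W \<mu>0 r l n) (at_right 0)"
    using weber_reg_tendsto[of l n \<mu>0 r] \<open>n > 0\<close> assms by (simp add: H_W_eq)
qed (fact H_N_asymptotics[OF assms(1,2)] H_W_asymptotics[OF assms(1,2)] L_rl_asymptotics)+

end
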